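(* Let $d\ge1$, let $R=\rho O$ be a $d\times d$ integer matrix with $\rho>1$ and $O$ an orthogonal matrix, and let $B\subset\mathbb{Z}^d$ be a finite nonempty set whose elements lie in pairwise distinct cosets of $R(\mathbb{Z}^d)$ in $\mathbb{Z}^d$. Let $\mu(R,B)$ be the associated self-similar measure and assume that it satisfies the no-overlap condition. Then there exists a countable set $\Lambda\subset\mathbb{R}^d$ with Beurling dimension $\dim_B(\Lambda)=\log_\rho(\#B)$ such that $E(\Lambda)=\{e^{2\pi i\langle\lambda,x\rangle}:\lambda\in\Lambda\}$ is a Riesz sequence for $L^2(\mu(R,B))$.
   Context: A family $\{f_k\}$ in a Hilbert space is a Riesz sequence if there are $C,D>0$ with $C\sum|a_k|^2\le\|\sum a_kf_k\|^2\le D\sum|a_k|^2$ for all finitely supported scalar sequences $(a_k)$. With $\tau_b(x)=R^{-1}(x+b)$ for $b\in B$, $\mu=\mu(R,B)$ is the unique Borel probability measure satisfying $\mu(E)=\frac{1}{\#B}\sum_{b\in B}\mu(\tau_b^{-1}(E))$ for all Borel $E\subset\mathbb{R}^d$. Equivalently it is the infinite convolution $\delta_{R^{-1}B}*\delta_{R^{-2}B}*\cdots$, where $\delta_A=\frac{1}{\#A}\sum_{a\in A}\delta_a$ for a finite set $A$. No-overlap condition: with $\mathbf{B}_n=\{\sum_{k=1}^nR^{n-k}b_k:b_k\in B\}$ and $K_n=\{\sum_{k=n+1}^\infty R^{-k}b_k:b_k\in B\}$, one has $\mu\big((R^{-n}\mathbf{b}+K_n)\cap(R^{-n}\mathbf{b}'+K_n)\big)=0$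 for all $\mathbf{b}\neq\mathbf{b}'$ in $\mathbf{B}_n$ and all $n\ge1$. Beurling dimension: for countable $\Lambda\subset\mathbb{R}^d$ and $\alpha\ge0$, $D_\alpha^+(\Lambda)=\limsup_{h\to\infty}\sup_{x\in\mathbb{R}^d}\frac{\#(\Lambda\cap B(x,h))}{h^\alpha}$, where $B(x,h)=\{y:|y-x|<h\}$, and $\dim_B(\Lambda)=\sup\{\alpha:D_\alpha^+(\Lambda)>0\}$. *)

theory Defs
  imports "HOL-Probability.Probability"
begin

definition integer_lattice :: "(real ^ 'n) set" where
  "integer_lattice = {x. \<forall>i. x $ i \<in> \<int>}"

definition integer_matrix :: "real ^ 'n ^ 'm \<Rightarrow> bool" where
  "integer_matrix A \<longleftrightarrow> (\<forall>i j. A $ i $ j \<in> \<int>)"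

text \<open>The product on \<^typ>\<open>real ^ 'n ^ 'n\<close> given by the type class is componentwise, so
  \<open>R ^ k\<close> would not be the matrix power. Powers are iterates of the linear map instead.\<close>

definition mat_pow_vec :: "real ^ 'n ^ 'n \<Rightarrow> nat \<Rightarrow> real ^ 'n \<Rightarrow> real ^ 'n" where
  "mat_pow_vec A k = ((*v) A) ^^ k"

definition ifs_map :: "real ^ 'n ^ 'n \<Rightarrow> real ^ 'n \<Rightarrow> real ^ 'n \<Rightarrow> real ^ 'n" where
  "ifs_map R b x = matrix_inv R *v (x + b)"

text \<open>The measure \<open>\<mu>(R, B)\<close> is characterised by its defining property; for expanding \<open>R\<close> and
  finite nonempty \<open>B\<close> exactly one measure has it.\<close>

definition is_self_similar_measure ::
    "real ^ 'n ^ 'n \<Rightarrow> (real ^ 'n) set \<Rightarrow> (real ^ 'n) measure \<Rightarrow> bool" where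
  "is_self_similar_measure R B \<mu> \<longleftrightarrow>
     prob_space \<mu> \<and> sets \<mu> = sets borel \<and>
     (\<forall>E\<in>sets borel.
        measure \<mu> E = (1 / real (card B)) * (\<Sum>b\<in>B. measure \<mu> (ifs_map R b -` E)))"

definition digit_sums :: "real ^ 'n ^ 'n \<Rightarrow> (real ^ 'n) set \<Rightarrow> nat \<Rightarrow> (real ^ 'n) set" where
  "digit_sums R B n =
     {\<Sum>k=1..n. mat_pow_vec R (n - k) (b k) | b. \<forall>k. b k \<in> B}"

text \<open>In \<open>digit_tails\<close> the summation index is shifted: \<open>j\<close> stands for \<open>k - (n + 1)\<close>.\<close>

definition digit_tails :: "real ^ 'n ^ 'n \<Rightarrow> (real ^ 'n) set \<Rightarrow> nat \<Rightarrow> (real ^ 'n) set" where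
  "digit_tails R B n =
     {\<Sum>j. mat_pow_vec (matrix_inv R) (n + 1 + j) (b (n + 1 + j)) | b. \<forall>k. b k \<in> B}"

definition no_overlap ::
    "real ^ 'n ^ 'n \<Rightarrow> (real ^ 'n) set \<Rightarrow> (real ^ 'n) measure \<Rightarrow> bool" where
  "no_overlap R B \<mu> \<longleftrightarrow>
     (\<forall>n\<ge>1. \<forall>b\<in>digit_sums R B n. \<forall>b'\<in>digit_sums R B n. b \<noteq> b' \<longrightarrow>
        emeasure \<mu> ((+) (mat_pow_vec (matrix_inv R) n b) ` digit_tails R B n \<inter>
                    (+) (mat_pow_vec (matrix_inv R) n b') ` digit_tails R B n) = 0)"

text \<open>Points are counted by \<^const>\<open>count_space\<close>, which gives infinite sets the value
  \<open>\<infinity>\<close>; \<^const>\<open>card\<close> would give \<open>0\<close>.\<close>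

definition upper_beurling_density :: "real \<Rightarrow> 'a::metric_space set \<Rightarrow> ennreal" where
  "upper_beurling_density \<alpha> \<Lambda> =
     Limsup at_top (\<lambda>h::real.
       SUP x. emeasure (count_space UNIV) (\<Lambda> \<inter> ball x h) / ennreal (h powr \<alpha>))"

text \<open>The supremum is taken in the extended reals, so it may be \<open>\<infinity>\<close>; for \<open>\<Lambda> = {}\<close> it is the
  supremum of the empty set, \<open>- \<infinity>\<close>.\<close>

definition beurling_dim :: "'a::metric_space set \<Rightarrow> ereal" where
  "beurling_dim \<Lambda> = Sup {ereal \<alpha> | \<alpha>. 0 \<le> \<alpha> \<and> upper_beurling_density \<alpha> \<Lambda> > 0}"

text \<open>Elements of the complex space \<open>L\<^sup>2(M)\<close> are represented by square-integrable functions.\<close>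

definition in_L2 :: "'a measure \<Rightarrow> ('a \<Rightarrow> complex) \<Rightarrow> bool" where
  "in_L2 M f \<longleftrightarrow> f \<in> borel_measurable M \<and> integrable M (\<lambda>x. (cmod (f x))\<^sup>2)"

definition L2_norm :: "'a measure \<Rightarrow> ('a \<Rightarrow> complex) \<Rightarrow> real" where
  "L2_norm M f = sqrt (LINT x|M. (cmod (f x))\<^sup>2)"

definition riesz_sequence_L2 ::
    "'a measure \<Rightarrow> 'i set \<Rightarrow> ('i \<Rightarrow> 'a \<Rightarrow> complex) \<Rightarrow> bool" where
  "riesz_sequence_L2 M I f \<longleftrightarrow>
     (\<forall>k\<in>I. in_L2 M (f k)) \<and>
     (\<exists>C>0. \<exists>D>0. \<forall>F a. finite F \<and> F \<subseteq> I \<longrightarrow>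
        C * (\<Sum>k\<in>F. (cmod (a k))\<^sup>2) \<le> (L2_norm M (\<lambda>x. \<Sum>k\<in>F. a k * f k x))\<^sup>2 \<and>
        (L2_norm M (\<lambda>x. \<Sum>k\<in>F. a k * f k x))\<^sup>2 \<le> D * (\<Sum>k\<in>F. (cmod (a k))\<^sup>2))"

definition exponential :: "'a::real_inner \<Rightarrow> 'a \<Rightarrow> complex" where
  "exponential l x = exp (2 * complex_of_real pi * \<i> * complex_of_real (l \<bullet> x))"

end

theory Submission
  imports Defs
begin

text \<open>
  The \<open>N ^ n\<close> points \<open>\<tau>\<^sub>w(0)\<close> with \<open>w\<close> a word of length \<open>n\<close> over \<open>B\<close>, \<open>N = #B\<close>, are distinct modulo the
  integer lattice, so the characters with frequencies in a fundamental domain of the dual lattice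
  form a tight frame on them. Let \<open>H\<close> be the off-diagonal part of the Gram matrix of a set of
  characters. Enlarging the set by one frequency at a time, always choosing one for which all the
  closed walks through it of length at most \<open>2p\<close> have small weight, keeps the trace of
  \<open>H ^ (2 p)\<close> so small that \<open>N ^ (n (1 - 1/p))\<close> characters remain orthonormal up to any prescribed
  \<open>\<epsilon>\<close>. This loses an arbitrarily small power compared with restricted invertibility theorems,
  which the dimension does not see.

  If \<open>\<Lambda>\<close> is good at level \<open>m\<close> and \<open>L\<close> at level \<open>n\<close>, then \<open>\<Lambda> + (R\<^sup>T) ^ m L\<close> is good at level \<open>m + n\<close>
  with the products of the bounds, and goodness at any level gives the same Riesz bounds for \<open>\<mu>\<close>.
  An increasing union of such sums has the required lower density. The upper bound for the
  dimension holds for every Bessel sequence, because small balls around the \<open>\<tau>\<^sub>w(0)\<close> have mass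
  of the order of \<open>N ^ (- n)\<close>.
\<close>

section \<open>Weighted path sums\<close>

text \<open>The sizes come from an average. A row of a tight Gram matrix with \<open>card E\<close>
  columns has squared norm \<open>card E / s\<close>, so a squared entry is about
  \<open>1 / s\<close>, and among \<open>k\<close> frequencies a walk of length \<open>j\<close>
  should weigh about \<open>\<theta> ^ j\<close> with \<open>\<theta> = sqrt (k / s)\<close>. The
  trace of the power \<open>2 * p\<close> is then of order \<open>k * (k / s) ^ p\<close>, which
  tends to 0 when \<open>k\<close> is \<open>s\<close> to the power \<open>1 - 1/p\<close>; this is
  the origin of the exponent. The obstacle is that choosing a frequency by averaging seems to
  require the very traces that are to be bounded. But the diagonal entry at \<open>e\<close> of an
  even power is the squared norm of a column, and tightness bounds the sum of these over all new
  \<open>e\<close> by the trace of the power lower by 2. The constants therefore form a triangular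
  system that depends on \<open>p\<close> only, not on \<open>s\<close>. Diagonal entries of odd
  powers have no sign and cannot be averaged in this way; they are interpolated between the even
  ones.\<close>

text \<open>The index counts the intermediate vertices, so \<open>path_sum h L j\<close> corresponds to the matrix
  power \<open>h ^ (j + 1)\<close>; the end points need not lie in \<open>L\<close>.\<close>

fun path_sum :: "('a \<Rightarrow> 'a \<Rightarrow> complex) \<Rightarrow> 'a set \<Rightarrow> nat \<Rightarrow> 'a \<Rightarrow> 'a \<Rightarrow> complex" where
  "path_sum h L 0 a b = h a b"
| "path_sum h L (Suc j) a b = (\<Sum>c\<in>L. h a c * path_sum h L j c b)"

text \<open>The vertex at which the two walks are joined becomes intermediate, hence the
  \<open>Suc\<close>.\<close>

lemma path_sum_concat:
  "path_sum h L (Suc (m + n)) a b = (\<Sum>c\<in>L. path_sum h L m a c * path_sum h L n c b)"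
proof (induction m arbitrary: a)
  case (Suc m)
  have "path_sum h L (Suc (Suc m + n)) a b = (\<Sum>d\<in>L. h a d * path_sum h L (Suc (m + n)) d b)"
    by simp
  also have "\<dots> = (\<Sum>d\<in>L. \<Sum>c\<in>L. h a d * (path_sum h L m d c * path_sum h L n c b))"
    by (simp only: Suc.IH sum_distrib_left)
  also have "\<dots> = (\<Sum>c\<in>L. \<Sum>d\<in>L. h a d * (path_sum h L m d c * path_sum h L n c b))"
    by (rule sum.swap)
  also have "\<dots> = (\<Sum>c\<in>L. path_sum h L (Suc m) a c * path_sum h L n c b)"
    by (simp add: sum_distrib_right mult.assoc)
  finally show ?case .
qed simp

lemma path_sum_Suc_right:
  "path_sum h L (Suc j) a b = (\<Sum>c\<in>L. path_sum h L j a c * h c b)"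
  using path_sum_concat[of h L j 0 a b] by simp

lemma path_sum_cnj:
  assumes "\<And>a b. cnj (h a b) = h b a"
  shows "cnj (path_sum h L j a b) = path_sum h L j b a"
proof (induction j arbitrary: a b)
  case (Suc j)
  have "cnj (path_sum h L (Suc j) a b) = (\<Sum>c\<in>L. path_sum h L j b c * h c a)"
    by (simp add: Suc.IH assms mult.commute)
  then show ?case
    by (simp only: path_sum_Suc_right)
qed (simp add: assms)

text \<open>A walk that meets \<open>e\<close> is cut at its first visit: the piece before it stays
  in \<open>L\<close>, the piece after it may return to \<open>e\<close>. The visit takes one of the
  \<open>j\<close> intermediate places, which leaves \<open>j - 1 - i\<close> for the second
  piece.\<close>

lemma path_sum_insert_first:
  assumes "finite L" "e \<notin> L"
  shows "path_sum h (insert e L) j a b = path_sum h L j a b +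
    (\<Sum>i<j. path_sum h L i a e * path_sum h (insert e L) (j - 1 - i) e b)"
proof (induction j arbitrary: a)
  case (Suc j)
  let ?P = "path_sum h L" and ?Q = "path_sum h (insert e L)"
  have "?Q (Suc j) a b = h a e * ?Q j e b + (\<Sum>c\<in>L. h a c * ?Q j c b)"
    using assms by simp
  also have "(\<Sum>c\<in>L. h a c * ?Q j c b)
      = (\<Sum>c\<in>L. h a c * ?P j c b) + (\<Sum>c\<in>L. \<Sum>i<j. h a c * (?P i c e * ?Q (j - 1 - i) e b))"
    by (subst Suc.IH) (simp add: sum.distrib distrib_left sum_distrib_left)
  also have "(\<Sum>c\<in>L. \<Sum>i<j. h a c * (?P i c e * ?Q (j - 1 - i) e b))
      = (\<Sum>i<j. ?P (Suc i) a e * ?Q (j - 1 - i) e b)"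
    by (subst sum.swap) (simp add: sum_distrib_right mult.assoc)
  finally show ?case
    by (simp add: sum.lessThan_Suc_shift del: sum.lessThan_Suc)
qed simp

text \<open>Conjugation reverses walks and so turns the first visit into the last one.\<close>

lemma path_sum_insert_last:
  assumes "finite L" "e \<notin> L" and h: "\<And>a b. cnj (h a b) = h b a"
  shows "path_sum h (insert e L) j b a = path_sum h L j b a +
    (\<Sum>i<j. path_sum h (insert e L) (j - 1 - i) b e * path_sum h L i e a)"
  using arg_cong[OF path_sum_insert_first[OF assms(1,2), of h j a b], of cnj]
  by (simp add: path_sum_cnj[OF h] mult.commute)

section \<open>Traces after the insertion of one vertex\<close>

definition path_trace :: "('a \<Rightarrow> 'a \<Rightarrow> complex) \<Rightarrow> 'a set \<Rightarrow> nat \<Rightarrow> complex" where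
  "path_trace h L j = (\<Sum>a\<in>L. path_sum h L j a a)"

text \<open>Cutting a closed walk from \<open>a\<close> at its first and last visits to
  \<open>e\<close> leaves two end pieces inside \<open>L\<close>; summation over \<open>a\<close>
  joins them into one closed walk at \<open>e\<close>. Hence the increment of the trace involves
  only closed walks at the new vertex.\<close>

lemma path_trace_insert:
  assumes L: "finite L" "e \<notin> L" and h: "\<And>a b. cnj (h a b) = h b a"
  shows "path_trace h (insert e L) j = path_trace h L j + path_sum h (insert e L) j e e +
    (\<Sum>i<j. path_sum h L j e e + (\<Sum>l<j - 1 - i.
      path_sum h (insert e L) (j - 1 - i - 1 - l) e e * path_sum h L (Suc (l + i)) e e))"
proof -
  let ?P = "path_sum h L" and ?Q = "path_sum h (insert e L)"
  have *: "(\<Sum>a\<in>L. ?P i a e * ?Q (j - 1 - i) e a)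
      = ?P j e e + (\<Sum>l<j - 1 - i. ?Q (j - 1 - i - 1 - l) e e * ?P (Suc (l + i)) e e)"
    if "i < j" for i
  proof -
    define m where "m = j - 1 - i"
    have j: "j = Suc (m + i)" using that by (simp add: m_def)
    \<comment> \<open>The first sum collects the walks with a single visit to \<open>e\<close>, the
      second those that visit \<open>e\<close> again.\<close>
    have "(\<Sum>a\<in>L. ?P i a e * ?Q m e a) = (\<Sum>a\<in>L. ?P m e a * ?P i a e) +
        (\<Sum>a\<in>L. \<Sum>l<m. ?Q (m - 1 - l) e e * (?P l e a * ?P i a e))"
      by (subst path_sum_insert_last[OF L h])
        (simp add: distrib_left sum.distrib sum_distrib_left mult_ac)
    also have "(\<Sum>a\<in>L. ?P m e a * ?P i a e) = ?P j e e"
      unfolding j path_sum_concat ..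
    also have "(\<Sum>a\<in>L. \<Sum>l<m. ?Q (m - 1 - l) e e * (?P l e a * ?P i a e))
       = (\<Sum>l<m. ?Q (m - 1 - l) e e * ?P (Suc (l + i)) e e)"
      by (subst sum.swap) (simp only: path_sum_concat sum_distrib_left)
    finally show ?thesis unfolding m_def .
  qed
  have "path_trace h (insert e L) j = ?Q j e e + (\<Sum>a\<in>L. ?Q j a a)"
    using L by (simp add: path_trace_def)
  also have "(\<Sum>a\<in>L. ?Q j a a)
      = path_trace h L j + (\<Sum>a\<in>L. \<Sum>i<j. ?P i a e * ?Q (j - 1 - i) e a)"
    by (subst path_sum_insert_first[OF L]) (simp add: path_trace_def sum.distrib)
  also have "(\<Sum>a\<in>L. \<Sum>i<j. ?P i a e * ?Q (j - 1 - i) e a)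
      = (\<Sum>i<j. \<Sum>a\<in>L. ?P i a e * ?Q (j - 1 - i) e a)"
    by (rule sum.swap)
  also have "\<dots> = (\<Sum>i<j. ?P j e e + (\<Sum>l<j - 1 - i. ?Q (j - 1 - i - 1 - l) e e * ?P (Suc (l + i)) e e))"
    by (rule sum.cong) (use * in auto)
  finally show ?thesis by simp
qed

text \<open>Solves the renewal recursion \<open>q j = A + (\<Sum>i<j. A * q (j - 1 - i))\<close>,
  which the path sums at \<open>e\<close> satisfy as an inequality when \<open>A\<close> bounds all
  normalised returns that avoid \<open>e\<close> in between.\<close>

lemma geometric_renewal:
  fixes A :: real
  shows "A * (1 + A) ^ j = A + (\<Sum>i<j. A * (A * (1 + A) ^ (j - 1 - i)))"
proof (induction j)
  case (Suc j)
  have "(\<Sum>i<Suc j. A * (A * (1 + A) ^ (Suc j - 1 - i))) =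
     A * (A * (1 + A) ^ j) + (\<Sum>i<j. A * (A * (1 + A) ^ (j - 1 - i)))"
    by (simp add: sum.lessThan_Suc_shift del: sum.lessThan_Suc)
  then show ?case using Suc by (simp add: algebra_simps)
qed simp

text \<open>The lengths of the two pieces of a walk cut at \<open>e\<close> add up, so the powers of
  \<open>\<theta>\<close> factor out of the first-visit formula and the renewal recursion
  remains.\<close>

lemma path_sum_insert_bound:
  fixes A \<theta> :: real
  assumes L: "finite L" "e \<notin> L" and "A \<ge> 0" "\<theta> \<ge> 0"
    and bd: "\<And>i. i \<le> J \<Longrightarrow> cmod (path_sum h L i e e) \<le> A * \<theta> ^ Suc i"
    and "j \<le> J"
  shows "cmod (path_sum h (insert e L) j e e) \<le> A * (1 + A) ^ j * \<theta> ^ Suc j"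
  using \<open>j \<le> J\<close>
proof (induction j rule: less_induct)
  case (less j)
  let ?P = "path_sum h L" and ?Q = "path_sum h (insert e L)"
  have t: "cmod (?P i e e * ?Q (j - 1 - i) e e) \<le> A * (A * (1 + A) ^ (j - 1 - i)) * \<theta> ^ Suc j"
    if "i < j" for i
  proof -
    have "cmod (?P i e e) * cmod (?Q (j - 1 - i) e e)
        \<le> (A * \<theta> ^ Suc i) * (A * (1 + A) ^ (j - 1 - i) * \<theta> ^ Suc (j - 1 - i))"
      using assms that less.prems by (intro mult_mono bd less.IH) auto
    also have "\<dots> = A * (A * (1 + A) ^ (j - 1 - i)) * (\<theta> ^ Suc i * \<theta> ^ Suc (j - 1 - i))"
      by (simp only: mult_ac)
    also have "\<theta> ^ Suc i * \<theta> ^ Suc (j - 1 - i) = \<theta> ^ Suc j"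
      using that by (simp flip: power_add power_Suc)
    finally show ?thesis by (simp add: norm_mult)
  qed
  have "cmod (?Q j e e) \<le> cmod (?P j e e) + (\<Sum>i<j. cmod (?P i e e * ?Q (j - 1 - i) e e))"
    by (subst path_sum_insert_first[OF L]) (intro norm_triangle_mono order_refl norm_sum)
  also have "\<dots> \<le> A * \<theta> ^ Suc j + (\<Sum>i<j. A * (A * (1 + A) ^ (j - 1 - i)) * \<theta> ^ Suc j)"
    by (intro add_mono sum_mono t bd less.prems) auto
  also have "\<dots> = (A + (\<Sum>i<j. A * (A * (1 + A) ^ (j - 1 - i)))) * \<theta> ^ Suc j"
    by (simp only: distrib_right sum_distrib_right)
  also have "\<dots> = A * (1 + A) ^ j * \<theta> ^ Suc j"
    by (simp only: geometric_renewal[symmetric])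
  finally show ?case .
qed

text \<open>In the factor \<open>real j + 1\<close>, the 1 stands for the closed walks that start at
  \<open>e\<close>, and \<open>j\<close> for the possible positions of the first visit to
  \<open>e\<close> in those that start in \<open>L\<close>; each contribution is again a renewal
  sum.\<close>

lemma path_trace_insert_bound:
  fixes A \<theta> :: real
  assumes L: "finite L" "e \<notin> L" and h: "\<And>a b. cnj (h a b) = h b a"
    and A: "A \<ge> 0" "\<theta> \<ge> 0"
    and bd: "\<And>i. i \<le> j \<Longrightarrow> cmod (path_sum h L i e e) \<le> A * \<theta> ^ Suc i"
  shows "cmod (path_trace h (insert e L) j)
    \<le> cmod (path_trace h L j) + (real j + 1) * (A * (1 + A) ^ j) * \<theta> ^ Suc j"
proof -
  let ?P = "path_sum h L" and ?Q = "path_sum h (insert e L)"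
  note Q = path_sum_insert_bound[OF L A bd]
  have t: "cmod (?P j e e + (\<Sum>l<j - 1 - i. ?Q (j - 1 - i - 1 - l) e e * ?P (Suc (l + i)) e e))
      \<le> A * (1 + A) ^ j * \<theta> ^ Suc j" if "i < j" for i
  proof -
    define m where "m = j - 1 - i"
    have j: "j = Suc (m + i)" using that by (simp add: m_def)
    have s: "cmod (?Q (m - 1 - l) e e * ?P (Suc (l + i)) e e)
        \<le> A * (A * (1 + A) ^ (m - 1 - l)) * \<theta> ^ Suc j" if "l < m" for l
    proof -
      have "cmod (?Q (m - 1 - l) e e) * cmod (?P (Suc (l + i)) e e)
        \<le> (A * (1 + A) ^ (m - 1 - l) * \<theta> ^ Suc (m - 1 - l)) * (A * \<theta> ^ Suc (Suc (l + i)))"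
        using A that j by (intro mult_mono bd Q) auto
      also have "\<dots> = A * (A * (1 + A) ^ (m - 1 - l)) * (\<theta> ^ Suc (m - 1 - l) * \<theta> ^ Suc (Suc (l + i)))"
        by (simp only: mult_ac)
      also have "\<theta> ^ Suc (m - 1 - l) * \<theta> ^ Suc (Suc (l + i)) = \<theta> ^ Suc j"
        using that j by (simp flip: power_add power_Suc)
      finally show ?thesis by (simp add: norm_mult)
    qed
    have "cmod (?P j e e + (\<Sum>l<m. ?Q (m - 1 - l) e e * ?P (Suc (l + i)) e e))
      \<le> cmod (?P j e e) + (\<Sum>l<m. cmod (?Q (m - 1 - l) e e * ?P (Suc (l + i)) e e))"
      by (intro norm_triangle_mono order_refl norm_sum)
    also have "\<dots> \<le> A * \<theta> ^ Suc j + (\<Sum>l<m. A * (A * (1 + A) ^ (m - 1 - l)) * \<theta> ^ Suc j)"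
      by (intro add_mono sum_mono s bd) auto
    also have "\<dots> = (A + (\<Sum>l<m. A * (A * (1 + A) ^ (m - 1 - l)))) * \<theta> ^ Suc j"
      by (simp only: distrib_right sum_distrib_right)
    also have "\<dots> = A * (1 + A) ^ m * \<theta> ^ Suc j"
      by (simp only: geometric_renewal[symmetric])
    also have "\<dots> \<le> A * (1 + A) ^ j * \<theta> ^ Suc j"
      using A j by (intro mult_right_mono mult_left_mono power_increasing) auto
    finally show ?thesis unfolding m_def .
  qed
  have "cmod (path_trace h (insert e L) j) \<le> cmod (path_trace h L j) + cmod (?Q j e e) +
     (\<Sum>i<j. cmod (?P j e e + (\<Sum>l<j - 1 - i. ?Q (j - 1 - i - 1 - l) e e * ?P (Suc (l + i)) e e)))"
    by (subst path_trace_insert[OF L h]) (intro norm_triangle_mono order_refl norm_sum)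
  also have "\<dots> \<le> cmod (path_trace h L j) + A * (1 + A) ^ j * \<theta> ^ Suc j
     + (\<Sum>i<j. A * (1 + A) ^ j * \<theta> ^ Suc j)"
    by (intro add_mono sum_mono t Q) auto
  also have "\<dots> = cmod (path_trace h L j) + (real j + 1) * (A * (1 + A) ^ j) * \<theta> ^ Suc j"
    by (simp add: algebra_simps)
  finally show ?thesis .
qed

section \<open>Well-conditioned subsets of tight frames\<close>

lemma Cauchy_Schwarz_cmod_sum:
  fixes x y :: "'a \<Rightarrow> complex"
  shows "(cmod (\<Sum>a\<in>L. x a * y a))\<^sup>2 \<le> (\<Sum>a\<in>L. (cmod (x a))\<^sup>2) * (\<Sum>a\<in>L. (cmod (y a))\<^sup>2)"
proof -
  have "cmod (\<Sum>a\<in>L. x a * y a) \<le> (\<Sum>a\<in>L. cmod (x a) * cmod (y a))"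
    using norm_sum[of "\<lambda>a. x a * y a" L] by (simp add: norm_mult)
  then have "(cmod (\<Sum>a\<in>L. x a * y a))\<^sup>2 \<le> (\<Sum>a\<in>L. cmod (x a) * cmod (y a))\<^sup>2"
    by (intro power_mono) auto
  also have "\<dots> \<le> (\<Sum>a\<in>L. (cmod (x a))\<^sup>2) * (\<Sum>a\<in>L. (cmod (y a))\<^sup>2)"
    by (rule Cauchy_Schwarz_ineq_sum)
  finally show ?thesis .
qed

text \<open>An odd number of intermediate vertices is an even matrix power: the walk has a middle
  vertex, and its two halves are conjugate to each other.\<close>

lemma path_sum_odd:
  assumes "\<And>a b. cnj (h a b) = h b a"
  shows "path_sum h L (Suc (2 * i)) e e = of_real (\<Sum>a\<in>L. (cmod (path_sum h L i a e))\<^sup>2)"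
proof -
  have "path_sum h L (Suc (i + i)) e e = (\<Sum>a\<in>L. cnj (path_sum h L i a e) * path_sum h L i a e)"
    unfolding path_sum_concat by (simp only: path_sum_cnj[OF assms])
  also have "\<dots> = (\<Sum>a\<in>L. of_real ((cmod (path_sum h L i a e))\<^sup>2))"
    by (intro sum.cong refl) (simp only: complex_norm_square mult.commute)
  finally show ?thesis by (simp add: mult_2)
qed

lemma path_trace_odd:
  assumes "\<And>a b. cnj (h a b) = h b a"
  shows "path_trace h L (Suc (2 * i)) = of_real (\<Sum>e\<in>L. \<Sum>a\<in>L. (cmod (path_sum h L i a e))\<^sup>2)"
  unfolding path_trace_def by (simp only: path_sum_odd[OF assms] of_real_sum)

text \<open>The trace of the power \<open>2 * p\<close> is the squared Hilbert-Schmidt norm of the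
  power \<open>p\<close> and so bounds its operator norm. Log-convexity of the norms of the iterates
  of \<open>f\<close> carries this back to the first power.\<close>

lemma quadratic_form_bound:
  fixes f :: "'a \<Rightarrow> complex"
  assumes "finite L" and h: "\<And>a b. cnj (h a b) = h b a" and "p \<ge> 1" and "\<epsilon> > 0"
    and tr: "cmod (path_trace h L (2 * p - 1)) \<le> \<epsilon> ^ (2 * p)"
  shows "cmod (\<Sum>a\<in>L. \<Sum>b\<in>L. cnj (f a) * h a b * f b) \<le> \<epsilon> * (\<Sum>a\<in>L. (cmod (f a))\<^sup>2)"
proof -
  define v where "v = rec_nat f (\<lambda>_ g a. \<Sum>b\<in>L. h a b * g b)"
  have v0: "v 0 = f" and vS: "v (Suc j) a = (\<Sum>b\<in>L. h a b * v j b)" for j a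
    by (simp_all add: v_def)
  define n where "n j = (\<Sum>a\<in>L. (cmod (v j a))\<^sup>2)" for j
  have n_nonneg: "n j \<ge> 0" for j by (simp add: n_def sum_nonneg)
  have adj: "(\<Sum>a\<in>L. cnj (v i a) * v (Suc j) a) = (\<Sum>a\<in>L. cnj (v (Suc i) a) * v j a)" for i j
  proof -
    have "(\<Sum>a\<in>L. cnj (v i a) * v (Suc j) a) = (\<Sum>a\<in>L. \<Sum>b\<in>L. cnj (v i a) * (h a b * v j b))"
      by (simp add: vS sum_distrib_left)
    also have "\<dots> = (\<Sum>b\<in>L. \<Sum>a\<in>L. cnj (v i a) * (h a b * v j b))"
      by (rule sum.swap)
    also have "\<dots> = (\<Sum>b\<in>L. cnj (v (Suc i) b) * v j b)"
      unfolding vS cnj_sum complex_cnj_mult h sum_distrib_right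
      by (intro sum.cong refl) (simp only: mult_ac)
    finally show ?thesis .
  qed
  have sq: "of_real (n j) = (\<Sum>a\<in>L. cnj (v j a) * v j a)" for j
    unfolding n_def of_real_sum by (intro sum.cong refl) (simp only: complex_norm_square mult.commute)
  have logconvex: "(n (Suc j))\<^sup>2 \<le> n j * n (Suc (Suc j))" for j
  proof -
    have "n (Suc j) = cmod (\<Sum>a\<in>L. cnj (v j a) * v (Suc (Suc j)) a)"
      unfolding adj[of j "Suc j"] sq[symmetric] norm_of_real using n_nonneg by simp
    also have "\<dots>\<^sup>2 \<le> n j * n (Suc (Suc j))"
      unfolding n_def using Cauchy_Schwarz_cmod_sum[of "\<lambda>a. cnj (v j a)" "v (Suc (Suc j))" L] by simp
    finally show ?thesis .
  qed
  have v_path: "v (Suc j) a = (\<Sum>b\<in>L. path_sum h L j a b * f b)" for j a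
  proof (induction j arbitrary: a)
    case (Suc j)
    have "v (Suc (Suc j)) a = (\<Sum>c\<in>L. \<Sum>b\<in>L. h a c * (path_sum h L j c b * f b))"
      unfolding vS[of "Suc j"] Suc.IH sum_distrib_left ..
    also have "\<dots> = (\<Sum>b\<in>L. \<Sum>c\<in>L. h a c * (path_sum h L j c b * f b))" by (rule sum.swap)
    finally show ?case by (simp add: sum_distrib_right mult.assoc)
  qed (simp add: vS v0)
  define S where "S = (\<Sum>e\<in>L. \<Sum>a\<in>L. (cmod (path_sum h L (p - 1) a e))\<^sup>2)"
  have "Suc (2 * (p - 1)) = 2 * p - 1" using \<open>p \<ge> 1\<close> by simp
  with path_trace_odd[of h L "p - 1", OF h] have "path_trace h L (2 * p - 1) = of_real S"
    unfolding S_def by simp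
  with tr have S: "S \<le> \<epsilon> ^ (2 * p)" by (simp only: norm_of_real)
  have np: "n p \<le> \<epsilon> ^ (2 * p) * n 0"
  proof -
    have "n p = (\<Sum>a\<in>L. (cmod (\<Sum>b\<in>L. path_sum h L (p - 1) a b * f b))\<^sup>2)"
      using v_path[of "p - 1"] \<open>p \<ge> 1\<close> by (simp add: n_def)
    also have "\<dots> \<le> (\<Sum>a\<in>L. (\<Sum>b\<in>L. (cmod (path_sum h L (p - 1) a b))\<^sup>2) * n 0)"
      unfolding n_def v0 by (intro sum_mono Cauchy_Schwarz_cmod_sum)
    also have "\<dots> = S * n 0"
      unfolding S_def sum_distrib_right by (rule sum.swap)
    also have "\<dots> \<le> \<epsilon> ^ (2 * p) * n 0" using S n_nonneg by (intro mult_right_mono)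
    finally show ?thesis .
  qed
  \<comment> \<open>By log-convexity the quotients \<open>n (Suc j) / n j\<close> do not decrease.
    If the first one exceeded the square of \<open>\<epsilon>\<close>, all would, against the bound
    for \<open>n p\<close>.\<close>
  have n1: "n 1 \<le> \<epsilon>\<^sup>2 * n 0"
  proof (rule ccontr)
    assume "\<not> ?thesis"
    then have gt: "n 1 > \<epsilon>\<^sup>2 * n 0" by simp
    have pos: "n 0 > 0"
    proof (rule ccontr)
      assume "\<not> n 0 > 0"
      then have "n 0 = 0" using n_nonneg[of 0] by simp
      with logconvex[of 0] gt show False by simp
    qed
    have step: "n (Suc j) > \<epsilon>\<^sup>2 * n j \<and> n j > 0" for j
    proof (induction j)
      case 0 then show ?case using gt pos by simp
    next
      case (Suc j)
      have "\<epsilon>\<^sup>2 * n j > 0" using Suc \<open>\<epsilon> > 0\<close> by simp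
      then have p: "n (Suc j) > 0" using Suc by linarith
      have "n j * (\<epsilon>\<^sup>2 * n (Suc j)) < n (Suc j) * n (Suc j)"
        using mult_strict_right_mono[OF conjunct1[OF Suc] p] by (simp add: mult_ac)
      also have "\<dots> \<le> n j * n (Suc (Suc j))" using logconvex[of j] by (simp add: power2_eq_square)
      finally show ?case using Suc p by simp
    qed
    have "n j > (\<epsilon>\<^sup>2) ^ j * n 0" if "j \<ge> 1" for j
      using that
    proof (induction j rule: dec_induct)
      case base then show ?case using gt by simp
    next
      case (step j)
      have "(\<epsilon>\<^sup>2) ^ Suc j * n 0 = \<epsilon>\<^sup>2 * ((\<epsilon>\<^sup>2) ^ j * n 0)" by simp
      also have "\<dots> \<le> \<epsilon>\<^sup>2 * n j" using step by (intro mult_left_mono) auto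
      also have "\<dots> < n (Suc j)" using \<open>\<And>j. n (Suc j) > \<epsilon>\<^sup>2 * n j \<and> n j > 0\<close> by blast
      finally show ?case .
    qed
    from this[OF \<open>p \<ge> 1\<close>] np show False by (simp add: power_mult)
  qed
  have "(\<Sum>a\<in>L. \<Sum>b\<in>L. cnj (f a) * h a b * f b) = (\<Sum>a\<in>L. cnj (f a) * v 1 a)"
    by (simp add: vS v0 sum_distrib_left mult.assoc)
  then have "(cmod (\<Sum>a\<in>L. \<Sum>b\<in>L. cnj (f a) * h a b * f b))\<^sup>2
      \<le> (\<Sum>a\<in>L. (cmod (cnj (f a)))\<^sup>2) * (\<Sum>a\<in>L. (cmod (v 1 a))\<^sup>2)"
    by (simp only: Cauchy_Schwarz_cmod_sum)
  also have "\<dots> = n 0 * n 1" by (simp only: n_def v0 complex_mod_cnj)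
  also have "\<dots> \<le> n 0 * (\<epsilon>\<^sup>2 * n 0)" using n1 n_nonneg by (intro mult_left_mono)
  also have "\<dots> = (\<epsilon> * n 0)\<^sup>2" by (simp add: power2_eq_square)
  finally have "cmod (\<Sum>a\<in>L. \<Sum>b\<in>L. cnj (f a) * h a b * f b) \<le> \<epsilon> * n 0"
    by (rule power2_le_imp_le) (use \<open>\<epsilon> > 0\<close> n_nonneg[of 0] in simp)
  then show ?thesis by (simp add: n_def v0)
qed

text \<open>On \<open>E\<close>, tightness says that \<open>G\<close> times
  \<open>s / card E\<close> is a projection. Its trace is \<open>s\<close> because the diagonal of
  \<open>G\<close> is 1, so \<open>s\<close> plays the part of the dimension spanned by the
  frame.\<close>

locale tight_gram =
  fixes E :: "'a set" and G :: "'a \<Rightarrow> 'a \<Rightarrow> complex" and s :: real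
  assumes finite_E: "finite E" and E_nonempty: "E \<noteq> {}" and s_pos: "s > 0"
    and G_diag: "G a a = 1" and G_cnj: "cnj (G a b) = G b a"
    and tight: "(\<Sum>e\<in>E. G a e * G e b) = of_real (card E / s) * G a b"
begin

definition off :: "'a \<Rightarrow> 'a \<Rightarrow> complex" where
  "off a b = (if a = b then 0 else G a b)"

lemma off_cnj: "cnj (off a b) = off b a"
  by (simp add: off_def G_cnj)

lemma s_le_card: "s \<le> card E"
proof -
  obtain a where a: "a \<in> E" using E_nonempty by blast
  have "of_real (card E / s) = (\<Sum>e\<in>E. G a e * cnj (G a e))"
    using tight[of a a] by (simp add: G_diag G_cnj)
  also have "\<dots> = of_real (\<Sum>e\<in>E. (cmod (G a e))\<^sup>2)"
    unfolding of_real_sum by (intro sum.cong refl) (simp only: complex_norm_square)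
  finally have "card E / s = (\<Sum>e\<in>E. (cmod (G a e))\<^sup>2)" by (simp only: of_real_eq_iff)
  also have "\<dots> \<ge> (cmod (G a a))\<^sup>2" using a finite_E by (intro member_le_sum) auto
  finally show ?thesis using s_pos by (simp add: G_diag field_simps)
qed

text \<open>Parseval's identity of the tight frame, for the vector with coefficients
  \<open>u\<close>.\<close>

lemma sum_row_norms:
  assumes "finite L"
  shows "of_real (\<Sum>e\<in>E. (cmod (\<Sum>c\<in>L. u c * G c e))\<^sup>2)
    = of_real (card E / s) * (\<Sum>c\<in>L. \<Sum>c'\<in>L. u c * cnj (u c') * G c c')"
proof -
  have inner: "(\<Sum>e\<in>E. u c * cnj (u c') * (G c e * G e c'))
      = of_real (card E / s) * (u c * cnj (u c') * G c c')" for c c'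
    by (simp only: sum_distrib_left[symmetric] tight) (simp only: mult_ac)
  have "of_real ((cmod (\<Sum>c\<in>L. u c * G c e))\<^sup>2)
      = (\<Sum>c\<in>L. \<Sum>c'\<in>L. u c * cnj (u c') * (G c e * G e c'))" for e
    unfolding complex_norm_square cnj_sum complex_cnj_mult G_cnj sum_product
    by (intro sum.cong refl) (simp only: mult_ac)
  then have "of_real (\<Sum>e\<in>E. (cmod (\<Sum>c\<in>L. u c * G c e))\<^sup>2)
      = (\<Sum>e\<in>E. \<Sum>c\<in>L. \<Sum>c'\<in>L. u c * cnj (u c') * (G c e * G e c'))"
    by (simp only: of_real_sum)
  also have "\<dots> = (\<Sum>c\<in>L. \<Sum>e\<in>E. \<Sum>c'\<in>L. u c * cnj (u c') * (G c e * G e c'))"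
    by (rule sum.swap)
  also have "\<dots> = (\<Sum>c\<in>L. \<Sum>c'\<in>L. \<Sum>e\<in>E. u c * cnj (u c') * (G c e * G e c'))"
    by (intro sum.cong refl sum.swap)
  also have "\<dots> = (\<Sum>c\<in>L. \<Sum>c'\<in>L. of_real (card E / s) * (u c * cnj (u c') * G c c'))"
    by (simp only: inner)
  finally show ?thesis by (simp only: sum_distrib_left)
qed

lemma gram_eq_off:
  assumes "finite L"
  shows "(\<Sum>c\<in>L. \<Sum>c'\<in>L. cnj (f c) * G c c' * f c')
    = (\<Sum>c\<in>L. \<Sum>c'\<in>L. cnj (f c) * off c c' * f c') + of_real (\<Sum>c\<in>L. (cmod (f c))\<^sup>2)"
proof -
  have "(\<Sum>c'\<in>L. cnj (f c) * G c c' * f c')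
      = (\<Sum>c'\<in>L. cnj (f c) * off c c' * f c') + of_real ((cmod (f c))\<^sup>2)" if c: "c \<in> L" for c
  proof -
    have "(\<Sum>c'\<in>L. cnj (f c) * G c c' * f c')
      = (\<Sum>c'\<in>L. cnj (f c) * off c c' * f c' + (if c' = c then cnj (f c) * f c else 0))"
      by (intro sum.cong refl) (auto simp: off_def G_diag)
    also have "\<dots> = (\<Sum>c'\<in>L. cnj (f c) * off c c' * f c') + cnj (f c) * f c"
      using c assms by (simp add: sum.distrib)
    finally show ?thesis by (simp only: complex_norm_square mult.commute)
  qed
  then show ?thesis by (simp add: sum.distrib)
qed

text \<open>The factor 2 is \<open>1 + 1\<close>: the diagonal part of the Gram matrix is the
  identity, and the trace bound makes the off-diagonal part a contraction on
  \<open>L\<close>.\<close>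

lemma sum_row_norms_le:
  assumes L: "finite L" and "p \<ge> 1" and tr: "cmod (path_trace off L (2 * p - 1)) \<le> 1"
  shows "(\<Sum>e\<in>E. (cmod (\<Sum>c\<in>L. u c * G c e))\<^sup>2) \<le> 2 * card E / s * (\<Sum>c\<in>L. (cmod (u c))\<^sup>2)"
proof -
  let ?q = "\<Sum>c\<in>L. \<Sum>c'\<in>L. u c * cnj (u c') * G c c'"
  have "?q = (\<Sum>c\<in>L. \<Sum>c'\<in>L. cnj (cnj (u c)) * off c c' * cnj (u c'))
      + of_real (\<Sum>c\<in>L. (cmod (cnj (u c)))\<^sup>2)"
    unfolding gram_eq_off[OF L, symmetric] by (simp only: complex_cnj_cnj mult_ac)
  then have "cmod ?q \<le> cmod (\<Sum>c\<in>L. \<Sum>c'\<in>L. cnj (cnj (u c)) * off c c' * cnj (u c'))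
      + (\<Sum>c\<in>L. (cmod (u c))\<^sup>2)"
    using norm_triangle_ineq[of "\<Sum>c\<in>L. \<Sum>c'\<in>L. cnj (cnj (u c)) * off c c' * cnj (u c')"
        "of_real (\<Sum>c\<in>L. (cmod (cnj (u c)))\<^sup>2)"]
    by (simp only: norm_of_real) (simp add: sum_nonneg)
  also have "\<dots> \<le> 1 * (\<Sum>c\<in>L. (cmod (cnj (u c)))\<^sup>2) + (\<Sum>c\<in>L. (cmod (u c))\<^sup>2)"
    by (intro add_right_mono quadratic_form_bound[OF L _ \<open>p \<ge> 1\<close>]) (use tr off_cnj in auto)
  finally have q: "cmod ?q \<le> 2 * (\<Sum>c\<in>L. (cmod (u c))\<^sup>2)" by simp
  have "(\<Sum>e\<in>E. (cmod (\<Sum>c\<in>L. u c * G c e))\<^sup>2)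
      = cmod (of_real (\<Sum>e\<in>E. (cmod (\<Sum>c\<in>L. u c * G c e))\<^sup>2))"
    by (simp only: norm_of_real) (simp add: sum_nonneg)
  also have "\<dots> = card E / s * cmod ?q"
    unfolding sum_row_norms[OF L] norm_mult norm_of_real using s_pos by simp
  also have "\<dots> \<le> card E / s * (2 * (\<Sum>c\<in>L. (cmod (u c))\<^sup>2))"
    using q s_pos by (intro mult_left_mono) auto
  finally show ?thesis by (simp add: mult_ac)
qed

end

text \<open>\<open>walk_const p i\<close> is the constant in the bound for the trace of the power
  \<open>2 * i\<close>. The recursion is the factor \<open>(real j + 1) * (A * (1 + A) ^ j)\<close>
  from \<open>path_trace_insert_bound\<close> with \<open>j = Suc (2 * i)\<close> and
  \<open>A = 4 * real p * walk_const p i\<close>, where \<open>4 * real p\<close> is the loss in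
  Markov's inequality.\<close>

fun walk_const :: "nat \<Rightarrow> nat \<Rightarrow> real" where
  "walk_const p 0 = 1"
| "walk_const p (Suc i) = (2 * real i + 2) *
     ((4 * real p * walk_const p i) * (1 + 4 * real p * walk_const p i) ^ Suc (2 * i))"

lemma walk_const_bounds:
  assumes "p \<ge> 1"
  shows "walk_const p i \<ge> 1" and "walk_const p i \<le> walk_const p (Suc i)"
proof -
  have step: "x \<le> (2 * real i + 2) * ((4 * real p * x) * (1 + 4 * real p * x) ^ Suc (2 * i))"
    if "x \<ge> 1" for x :: real and i
  proof -
    have "1 * x \<le> 4 * real p * x" using that assms by (intro mult_right_mono) auto
    moreover have "(4 * real p * x) * 1 \<le> (4 * real p * x) * (1 + 4 * real p * x) ^ Suc (2 * i)"
      using that by (intro mult_left_mono one_le_power) auto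
    moreover have "1 * ((4 * real p * x) * (1 + 4 * real p * x) ^ Suc (2 * i))
        \<le> (2 * real i + 2) * ((4 * real p * x) * (1 + 4 * real p * x) ^ Suc (2 * i))"
      using that by (intro mult_right_mono) auto
    ultimately show ?thesis by linarith
  qed
  show ge: "walk_const p i \<ge> 1" for i
  proof (induction i)
    case (Suc i)
    show ?case
      unfolding walk_const.simps using Suc step[OF Suc, of i] by (rule order_trans)
  qed simp
  show "walk_const p i \<le> walk_const p (Suc i)"
    unfolding walk_const.simps by (rule step[OF ge])
qed

lemma walk_const_mono:
  assumes "p \<ge> 1" "i \<le> j"
  shows "walk_const p i \<le> walk_const p j"
  by (rule lift_Suc_mono_le[of "walk_const p"]) (rule walk_const_bounds(2)[OF assms(1)] assms(2))+

context tight_gram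
begin

text \<open>The case distinction is the trace of \<open>off ^ (2 i)\<close> on \<open>L\<close>, where \<open>path_trace\<close> has no index for
  the power 0.\<close>

lemma sum_path_sum_odd_le:
  assumes L: "finite L" "L \<subseteq> E" and "p \<ge> 1" and tr: "cmod (path_trace off L (2 * p - 1)) \<le> 1"
  shows "(\<Sum>e\<in>E - L. cmod (path_sum off L (Suc (2 * i)) e e)) \<le> 2 * card E / s *
    (case i of 0 \<Rightarrow> card L | Suc i' \<Rightarrow> cmod (path_trace off L (Suc (2 * i'))))"
proof -
  \<comment> \<open>\<open>u a\<close> is row \<open>a\<close> of the power \<open>i\<close> of
    \<open>off\<close> on \<open>L\<close>; for \<open>i = 0\<close> it is a row of the identity
    matrix, which no index of \<open>path_sum\<close> represents.\<close>
  define u where "u a c = (case i of 0 \<Rightarrow> if c = a then 1 else 0 | Suc i' \<Rightarrow> path_sum off L i' a c)" for a c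
  \<comment> \<open>For \<open>e\<close> outside \<open>L\<close> the last edge of the walk is never
    a diagonal entry, so \<open>off\<close> may be replaced by \<open>G\<close>, to which tightness
    applies.\<close>
  have u: "path_sum off L i a e = (\<Sum>c\<in>L. u a c * G c e)" if "a \<in> L" "e \<in> E - L" for a e
  proof (cases i)
    case 0
    have "(\<Sum>c\<in>L. u a c * G c e) = (\<Sum>c\<in>L. if c = a then G a e else 0)"
      by (intro sum.cong refl) (auto simp: u_def 0)
    then show ?thesis using that L by (auto simp: 0 off_def)
  next
    case (Suc i')
    have "(\<Sum>c\<in>L. u a c * G c e) = (\<Sum>c\<in>L. path_sum off L i' a c * off c e)"
      using that by (intro sum.cong refl) (auto simp: u_def Suc off_def)
    then show ?thesis by (simp only: Suc path_sum_Suc_right)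
  qed
  have nu: "(\<Sum>a\<in>L. \<Sum>c\<in>L. (cmod (u a c))\<^sup>2)
      = (case i of 0 \<Rightarrow> card L | Suc i' \<Rightarrow> cmod (path_trace off L (Suc (2 * i'))))"
  proof (cases i)
    case 0
    have "(\<Sum>c\<in>L. (cmod (u a c))\<^sup>2) = 1" if "a \<in> L" for a
    proof -
      have "(\<Sum>c\<in>L. (cmod (u a c))\<^sup>2) = (\<Sum>c\<in>L. if c = a then 1 else 0)"
        by (intro sum.cong refl) (auto simp: u_def 0)
      then show ?thesis using that L by simp
    qed
    then show ?thesis by (simp add: 0)
  next
    case (Suc i')
    have "(\<Sum>a\<in>L. \<Sum>c\<in>L. (cmod (u a c))\<^sup>2) = (\<Sum>e\<in>L. \<Sum>a\<in>L. (cmod (path_sum off L i' a e))\<^sup>2)"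
      unfolding u_def Suc by (subst sum.swap) simp
    then show ?thesis
      unfolding Suc nat.case path_trace_odd[of off, OF off_cnj] norm_of_real by (simp add: sum_nonneg)
  qed
  have "(\<Sum>e\<in>E - L. cmod (path_sum off L (Suc (2 * i)) e e))
      = (\<Sum>e\<in>E - L. \<Sum>a\<in>L. (cmod (path_sum off L i a e))\<^sup>2)"
    unfolding path_sum_odd[of off, OF off_cnj] norm_of_real by (simp add: sum_nonneg)
  also have "\<dots> = (\<Sum>e\<in>E - L. \<Sum>a\<in>L. (cmod (\<Sum>c\<in>L. u a c * G c e))\<^sup>2)"
    by (intro sum.cong refl) (simp only: u)
  also have "\<dots> \<le> (\<Sum>e\<in>E. \<Sum>a\<in>L. (cmod (\<Sum>c\<in>L. u a c * G c e))\<^sup>2)"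
    using finite_E by (intro sum_mono2) (auto intro: sum_nonneg)
  also have "\<dots> = (\<Sum>a\<in>L. \<Sum>e\<in>E. (cmod (\<Sum>c\<in>L. u a c * G c e))\<^sup>2)" by (rule sum.swap)
  also have "\<dots> \<le> (\<Sum>a\<in>L. 2 * card E / s * (\<Sum>c\<in>L. (cmod (u a c))\<^sup>2))"
    by (intro sum_mono sum_row_norms_le[OF L(1) \<open>p \<ge> 1\<close> tr])
  also have "\<dots> = 2 * card E / s * (\<Sum>a\<in>L. \<Sum>c\<in>L. (cmod (u a c))\<^sup>2)"
    by (simp only: sum_distrib_left)
  finally show ?thesis unfolding nu .
qed

text \<open>A vector whose closed path sums are all at most \<open>4p\<close> times their average over
  \<open>E\<close> exists by Markov's inequality applied to the sum of the \<open>p\<close> normalised path sums.\<close>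

lemma exists_small_path_sums:
  fixes k :: nat
  defines "\<theta> \<equiv> sqrt (k / s)"
  assumes L: "finite L" "L \<subseteq> E" and "p \<ge> 1" and k: "card L < k" "2 * real k \<le> s"
    and small: "walk_const p p * k * \<theta> ^ (2 * p) \<le> 1"
    and tr: "\<And>i. i < p \<Longrightarrow>
      cmod (path_trace off L (Suc (2 * i))) \<le> walk_const p (Suc i) * card L * \<theta> ^ (2 * i + 2)"
  shows "\<exists>e\<in>E - L. \<forall>i<p. cmod (path_sum off L (Suc (2 * i)) e e)
    \<le> 4 * real p * walk_const p i * \<theta> ^ (2 * i + 2)"
proof -
  have \<theta>: "\<theta> > 0" "\<theta>\<^sup>2 = k / s" using k s_pos by (auto simp: \<theta>_def)
  have wc: "walk_const p i > 0" for i using walk_const_bounds(1)[OF \<open>p \<ge> 1\<close>, of i] by linarith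
  have tr1: "cmod (path_trace off L (2 * p - 1)) \<le> 1"
  proof -
    have p: "Suc (2 * (p - 1)) = 2 * p - 1" "2 * (p - 1) + 2 = 2 * p" "Suc (p - 1) = p" "p - 1 < p"
      using \<open>p \<ge> 1\<close> by auto
    have "cmod (path_trace off L (2 * p - 1)) \<le> walk_const p p * card L * \<theta> ^ (2 * p)"
      using tr[of "p - 1"] by (simp only: p)
    also have "\<dots> \<le> walk_const p p * k * \<theta> ^ (2 * p)"
      using k wc[of p] \<theta> by (intro mult_right_mono mult_left_mono) auto
    finally show ?thesis using small by linarith
  qed
  define w where "w i = 4 * real p * walk_const p i * \<theta> ^ (2 * i + 2)" for i
  have w_pos: "w i > 0" for i using \<open>p \<ge> 1\<close> wc[of i] \<theta> by (simp add: w_def)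
  have sum_le: "(\<Sum>e\<in>E - L. cmod (path_sum off L (Suc (2 * i)) e e) / w i) < card E / (2 * p)"
    if "i < p" for i
  proof -
    have N: "(case i of 0 \<Rightarrow> card L | Suc i' \<Rightarrow> cmod (path_trace off L (Suc (2 * i'))))
        \<le> walk_const p i * card L * \<theta> ^ (2 * i)"
      using tr[of "i - 1"] that by (cases i) auto
    have "(\<Sum>e\<in>E - L. cmod (path_sum off L (Suc (2 * i)) e e))
        \<le> 2 * card E / s * (walk_const p i * card L * \<theta> ^ (2 * i))"
      using s_pos by (intro order_trans[OF sum_path_sum_odd_le[OF L \<open>p \<ge> 1\<close> tr1]] mult_left_mono N) auto
    also have "\<dots> < 2 * card E / s * (walk_const p i * k * \<theta> ^ (2 * i))"
      using s_pos wc[of i] \<theta> k finite_E E_nonempty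
      by (intro mult_strict_left_mono mult_strict_right_mono) (auto simp: card_gt_0_iff)
    also have "\<dots> = card E / (2 * p) * w i"
      using \<theta> s_pos \<open>p \<ge> 1\<close> by (simp add: w_def power_add field_simps power2_eq_square)
    finally show ?thesis using w_pos[of i] by (simp add: sum_divide_distrib[symmetric] field_simps)
  qed
  \<comment> \<open>At least half of \<open>E\<close> lies outside \<open>L\<close>; this is what
    makes the total below \<open>card E / 2\<close> force a single sum below 1.\<close>
  have cE: "2 * real (card L) \<le> card E" using k s_le_card by linarith
  have cd: "real (card (E - L)) = card E - card L"
    using L finite_E by (simp add: card_Diff_subset card_mono of_nat_diff)
  have "(\<Sum>e\<in>E - L. \<Sum>i<p. cmod (path_sum off L (Suc (2 * i)) e e) / w i)
      = (\<Sum>i<p. \<Sum>e\<in>E - L. cmod (path_sum off L (Suc (2 * i)) e e) / w i)" by (rule sum.swap)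
  also have "\<dots> < (\<Sum>i<p. card E / (2 * p))"
    using sum_le \<open>p \<ge> 1\<close> by (intro sum_strict_mono) (auto simp: lessThan_empty_iff)
  also have "\<dots> = card E / 2" using \<open>p \<ge> 1\<close> by simp
  also have "\<dots> \<le> (\<Sum>e\<in>E - L. 1)" using cE cd by simp
  finally have lt: "(\<Sum>e\<in>E - L. \<Sum>i<p. cmod (path_sum off L (Suc (2 * i)) e e) / w i) < (\<Sum>e\<in>E - L. 1)" .
  have "\<not> (\<forall>e\<in>E - L. 1 \<le> (\<Sum>i<p. cmod (path_sum off L (Suc (2 * i)) e e) / w i))"
  proof
    assume "\<forall>e\<in>E - L. 1 \<le> (\<Sum>i<p. cmod (path_sum off L (Suc (2 * i)) e e) / w i)"
    then have "(\<Sum>e\<in>E - L. 1) \<le> (\<Sum>e\<in>E - L. \<Sum>i<p. cmod (path_sum off L (Suc (2 * i)) e e) / w i)"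
      by (intro sum_mono) blast
    with lt show False by linarith
  qed
  then obtain e where e: "e \<in> E - L" "(\<Sum>i<p. cmod (path_sum off L (Suc (2 * i)) e e) / w i) < 1"
    by (auto simp: not_le)
  have "cmod (path_sum off L (Suc (2 * i)) e e) \<le> w i" if "i < p" for i
  proof -
    have "cmod (path_sum off L (Suc (2 * i)) e e) / w i
        \<le> (\<Sum>i<p. cmod (path_sum off L (Suc (2 * i)) e e) / w i)"
      using that w_pos by (intro member_le_sum) (auto intro!: divide_nonneg_pos)
    with e(2) have "cmod (path_sum off L (Suc (2 * i)) e e) / w i < 1" by linarith
    then show ?thesis unfolding divide_less_eq_1_pos[OF w_pos] by (rule less_imp_le)
  qed
  with e(1) show ?thesis unfolding w_def by (intro bexI[of _ e] allI impI)
qed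

text \<open>An even index is an odd power, whose diagonal entry is the inner product of two
  consecutive columns. Cauchy-Schwarz bounds it by the geometric mean of the neighbouring even
  powers.\<close>

lemma path_sum_even_bound:
  assumes "i \<ge> 1" "x \<ge> 0"
    and "cmod (path_sum off L (Suc (2 * (i - 1))) e e) \<le> x * \<theta> ^ (2 * i)"
    and "cmod (path_sum off L (Suc (2 * i)) e e) \<le> x * \<theta> ^ (2 * i + 2)" and "\<theta> \<ge> 0"
  shows "cmod (path_sum off L (2 * i) e e) \<le> x * \<theta> ^ (2 * i + 1)"
proof -
  have i: "2 * i = Suc ((i - 1) + i)" using \<open>i \<ge> 1\<close> by simp
  have eq: "path_sum off L (2 * i) e e = (\<Sum>a\<in>L. cnj (path_sum off L (i - 1) a e) * path_sum off L i a e)"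
    by (subst i, subst path_sum_concat) (simp add: path_sum_cnj[of off, OF off_cnj])
  have n: "(\<Sum>a\<in>L. (cmod (path_sum off L j a e))\<^sup>2) = cmod (path_sum off L (Suc (2 * j)) e e)" for j
    unfolding path_sum_odd[of off, OF off_cnj] norm_of_real by (simp add: sum_nonneg)
  have "(cmod (path_sum off L (2 * i) e e))\<^sup>2 \<le>
      cmod (path_sum off L (Suc (2 * (i - 1))) e e) * cmod (path_sum off L (Suc (2 * i)) e e)"
    unfolding eq n[symmetric]
    using Cauchy_Schwarz_cmod_sum[of "\<lambda>a. cnj (path_sum off L (i - 1) a e)" "\<lambda>a. path_sum off L i a e" L]
    by simp
  also have "\<dots> \<le> (x * \<theta> ^ (2 * i)) * (x * \<theta> ^ (2 * i + 2))"
    using assms by (intro mult_mono) auto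
  also have "\<dots> = (x * \<theta> ^ (2 * i + 1))\<^sup>2"
    by (simp add: power2_eq_square power_add)
  finally show ?thesis
    by (rule power2_le_imp_le) (intro mult_nonneg_nonneg zero_le_power assms)
qed

text \<open>The greedy selection: every insertion raises the trace by at most
  \<open>walk_const p (Suc i) * \<theta> ^ (2 * i + 2)\<close>, a bound that is the same for all
  \<open>m\<close>, so the estimate grows linearly.\<close>

lemma exists_small_path_trace:
  fixes k :: nat
  defines "\<theta> \<equiv> sqrt (k / s)"
  assumes "p \<ge> 1" and k: "2 * real k \<le> s"
    and small: "walk_const p p * k * \<theta> ^ (2 * p) \<le> 1" and "m \<le> k"
  shows "\<exists>L\<subseteq>E. card L = m \<and> (\<forall>i<p.
      cmod (path_trace off L (Suc (2 * i))) \<le> walk_const p (Suc i) * m * \<theta> ^ (2 * i + 2))"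
  using \<open>m \<le> k\<close>
proof (induction m)
  case 0
  then show ?case by (intro exI[of _ "{}"]) (auto simp: path_trace_def)
next
  case (Suc m)
  then obtain L where L: "L \<subseteq> E" "card L = m"
    and tr: "\<And>i. i < p \<Longrightarrow>
      cmod (path_trace off L (Suc (2 * i))) \<le> walk_const p (Suc i) * card L * \<theta> ^ (2 * i + 2)"
    by auto
  have fin: "finite L" using L finite_E finite_subset by blast
  have \<theta>: "\<theta> \<ge> 0" using s_pos by (simp add: \<theta>_def)
  obtain e where e: "e \<in> E - L" and
    P: "\<And>i. i < p \<Longrightarrow> cmod (path_sum off L (Suc (2 * i)) e e) \<le> 4 * real p * walk_const p i * \<theta> ^ (2 * i + 2)"
    using exists_small_path_sums[OF fin L(1) \<open>p \<ge> 1\<close> _ k small[unfolded \<theta>_def] tr[unfolded \<theta>_def]]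
      Suc.prems L(2) unfolding \<theta>_def by auto
  \<comment> \<open>Monotonicity of \<open>walk_const\<close> gives one constant for all shorter
    closed walks, as the renewal bound requires.\<close>
  have P': "cmod (path_sum off L (Suc (2 * i')) e e) \<le> 4 * real p * walk_const p i * \<theta> ^ (2 * i' + 2)"
    if "i' \<le> i" "i < p" for i i'
    using that walk_const_mono[OF \<open>p \<ge> 1\<close> that(1)] \<theta>
    by (intro order_trans[OF P[of i']] mult_right_mono mult_left_mono) auto
  have "cmod (path_trace off (insert e L) (Suc (2 * i)))
      \<le> walk_const p (Suc i) * Suc m * \<theta> ^ (2 * i + 2)" if i: "i < p" for i
  proof -
    define A where "A = 4 * real p * walk_const p i"
    have A: "A \<ge> 0" using walk_const_bounds(1)[OF \<open>p \<ge> 1\<close>, of i] by (simp add: A_def)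
    have all: "cmod (path_sum off L j e e) \<le> A * \<theta> ^ Suc j" if "j \<le> Suc (2 * i)" for j
    proof (cases "even j")
      case False
      then obtain i' where "j = Suc (2 * i')" by (auto elim: oddE)
      with P'[of i' i] that i show ?thesis by (simp add: A_def)
    next
      case True
      then obtain i' where j: "j = 2 * i'" by (auto elim: evenE)
      show ?thesis
      \<comment> \<open>Index 0 has no even power below it to interpolate from, but it is a diagonal
        entry of \<open>off\<close> and vanishes.\<close>
      proof (cases "i' = 0")
        case True
        then show ?thesis using A \<theta> by (simp add: j off_def)
      next
        case False
        then have eq: "2 * (i' - 1) + 2 = 2 * i'" and "i' - 1 \<le> i" "i' \<le> i" using that j by auto
        then show ?thesis
          using path_sum_even_bound[of i' A L e \<theta>] P'[of "i' - 1" i, unfolded eq] P'[of i' i]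
            False i A \<theta> by (simp add: j A_def)
      qed
    qed
    have "cmod (path_trace off (insert e L) (Suc (2 * i))) \<le> cmod (path_trace off L (Suc (2 * i)))
       + (real (Suc (2 * i)) + 1) * (A * (1 + A) ^ Suc (2 * i)) * \<theta> ^ Suc (Suc (2 * i))"
      using e fin off_cnj A \<theta> all by (intro path_trace_insert_bound) auto
    also have "(real (Suc (2 * i)) + 1) * (A * (1 + A) ^ Suc (2 * i)) * \<theta> ^ Suc (Suc (2 * i))
        = walk_const p (Suc i) * \<theta> ^ (2 * i + 2)"
      by (simp add: A_def)
    also have "cmod (path_trace off L (Suc (2 * i))) \<le> walk_const p (Suc i) * m * \<theta> ^ (2 * i + 2)"
      using tr[OF i] L by simp
    also have "walk_const p (Suc i) * m * \<theta> ^ (2 * i + 2) + walk_const p (Suc i) * \<theta> ^ (2 * i + 2)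
      = walk_const p (Suc i) * Suc m * \<theta> ^ (2 * i + 2)"
      by (simp only: of_nat_Suc distrib_left distrib_right mult_1_right)
    finally show ?thesis by simp
  qed
  moreover have "insert e L \<subseteq> E" "card (insert e L) = Suc m" using e L fin by auto
  ultimately show ?case by blast
qed

lemma exists_well_conditioned_subset:
  fixes k :: nat and \<epsilon> :: real
  assumes "p \<ge> 1" and k: "2 * real k \<le> s" and \<epsilon>: "0 < \<epsilon>" "\<epsilon> \<le> 1"
    and small: "walk_const p p * k * (k / s) ^ p \<le> \<epsilon> ^ (2 * p)"
  shows "\<exists>L\<subseteq>E. card L = k \<and> (\<forall>f. cmod ((\<Sum>a\<in>L. \<Sum>b\<in>L. cnj (f a) * G a b * f b) -
     of_real (\<Sum>a\<in>L. (cmod (f a))\<^sup>2)) \<le> \<epsilon> * (\<Sum>a\<in>L. (cmod (f a))\<^sup>2))"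
proof -
  have p: "Suc (2 * (p - 1)) = 2 * p - 1" "2 * (p - 1) + 2 = 2 * p" "Suc (p - 1) = p" "p - 1 < p"
    using \<open>p \<ge> 1\<close> by auto
  have sq: "sqrt (k / s) ^ (2 * p) = (k / s) ^ p"
    using real_sqrt_pow2[of "k / s"] s_pos by (simp only: power_mult) simp
  have "\<epsilon> ^ (2 * p) \<le> 1" using \<epsilon> by (simp add: power_le_one)
  then have "walk_const p p * k * sqrt (k / s) ^ (2 * p) \<le> 1" using small unfolding sq by linarith
  from exists_small_path_trace[OF \<open>p \<ge> 1\<close> k this order_refl]
  obtain L where L: "L \<subseteq> E" "card L = k" and "\<And>i. i < p \<Longrightarrow> cmod (path_trace off L (Suc (2 * i)))
      \<le> walk_const p (Suc i) * k * sqrt (k / s) ^ (2 * i + 2)" by blast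
  from this(3)[OF p(4)] have "cmod (path_trace off L (2 * p - 1)) \<le> walk_const p p * k * (k / s) ^ p"
    unfolding p sq .
  then have tr: "cmod (path_trace off L (2 * p - 1)) \<le> \<epsilon> ^ (2 * p)" using small by linarith
  have fin: "finite L" using L finite_E finite_subset by blast
  have "cmod ((\<Sum>a\<in>L. \<Sum>b\<in>L. cnj (f a) * G a b * f b) - of_real (\<Sum>a\<in>L. (cmod (f a))\<^sup>2))
      \<le> \<epsilon> * (\<Sum>a\<in>L. (cmod (f a))\<^sup>2)" for f
    unfolding gram_eq_off[OF fin] add_diff_cancel_right'
    using quadratic_form_bound[OF fin _ \<open>p \<ge> 1\<close> \<epsilon>(1) tr] off_cnj by blast
  with L show ?thesis by blast
qed

end

section \<open>The tight frame of characters on the points of a given level\<close>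

lemma exponential_add_left: "exponential (l + l') x = exponential l x * exponential l' x"
  by (simp add: exponential_def inner_add_left distrib_left exp_add)

lemma exponential_add_right: "exponential l (x + y) = exponential l x * exponential l y"
  by (simp add: exponential_def inner_add_right distrib_left exp_add)

lemma cnj_exponential: "cnj (exponential l x) = exponential (- l) x"
  by (simp add: exponential_def exp_cnj)

lemma exponential_uminus_right: "exponential l (- x) = exponential (- l) x"
  by (simp add: exponential_def)

lemma norm_exponential [simp]: "cmod (exponential l x) = 1"
  by (simp add: exponential_def)

lemma exponential_0 [simp]: "exponential 0 x = 1" "exponential l 0 = 1"
  by (simp_all add: exponential_def)

lemma exponential_eq_1_iff: "exponential l x = 1 \<longleftrightarrow> l \<bullet> x \<in> \<int>"
proof -
  have "exponential l x = 1 \<longleftrightarrow> (\<exists>n::int. 2 * pi * (l \<bullet> x) = of_int (2 * n) * pi)"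
    by (simp add: exponential_def exp_eq_1)
  also have "\<dots> \<longleftrightarrow> l \<bullet> x \<in> \<int>"
    by (auto simp: Ints_def)
  finally show ?thesis .
qed

lemma integer_lattice_closed:
  "0 \<in> integer_lattice"
  "x \<in> integer_lattice \<Longrightarrow> y \<in> integer_lattice \<Longrightarrow> x + y \<in> integer_lattice"
  "x \<in> integer_lattice \<Longrightarrow> y \<in> integer_lattice \<Longrightarrow> x - y \<in> integer_lattice"
  "axis i 1 \<in> integer_lattice"
  by (auto simp: integer_lattice_def axis_def)

lemma inner_integer_lattice:
  "x \<in> integer_lattice \<Longrightarrow> y \<in> integer_lattice \<Longrightarrow> x \<bullet> y \<in> \<int>"
  by (auto simp: integer_lattice_def inner_vec_def intro!: Ints_sum)

lemma integer_matrix_mult_lattice: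
  "integer_matrix A \<Longrightarrow> x \<in> integer_lattice \<Longrightarrow> A *v x \<in> integer_lattice"
  by (auto simp: integer_lattice_def integer_matrix_def matrix_vector_mult_def intro!: Ints_sum)

lemma finite_integer_lattice_bounded: "finite {x \<in> integer_lattice. norm (x::real^'n) \<le> r}"
proof -
  let ?I = "{t::real. t \<in> \<int> \<and> \<bar>t\<bar> \<le> r}"
  have "finite ?I" by (rule finite_abs_int_segment)
  then have "finite (UNIV \<rightarrow>\<^sub>E ?I :: ('n \<Rightarrow> real) set)" by (intro finite_PiE) auto
  moreover have "vec_nth ` {x \<in> integer_lattice. norm (x::real^'n) \<le> r} \<subseteq> (UNIV \<rightarrow>\<^sub>E ?I)"
    by (auto simp: integer_lattice_def intro: order_trans[OF component_le_norm_cart])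
  ultimately have "finite (vec_nth ` {x \<in> integer_lattice. norm (x::real^'n) \<le> r})"
    by (rule finite_subset[rotated])
  then show ?thesis by (rule finite_imageD) (auto simp: inj_on_def vec_nth_inject)
qed

lemma mat_pow_vec_0 [simp]: "mat_pow_vec A 0 x = x"
  by (simp add: mat_pow_vec_def)

lemma mat_pow_vec_Suc: "mat_pow_vec A (Suc n) x = A *v mat_pow_vec A n x"
  by (simp add: mat_pow_vec_def)

lemma mat_pow_vec_Suc': "mat_pow_vec A (Suc n) x = mat_pow_vec A n (A *v x)"
  by (simp add: mat_pow_vec_def funpow_swap1)

lemma linear_mat_pow_vec: "linear (mat_pow_vec A n)"
proof (induction n)
  case 0
  show ?case by (simp add: mat_pow_vec_def linear_id[unfolded id_def])
next
  case (Suc n)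
  have "linear ((*v) A \<circ> mat_pow_vec A n)"
    by (intro linear_compose Suc matrix_vector_mul_linear)
  then show ?case by (simp add: o_def mat_pow_vec_Suc[abs_def])
qed

lemmas mat_pow_vec_linear_simps [simp] =
  linear_add[OF linear_mat_pow_vec] linear_diff[OF linear_mat_pow_vec]
  linear_0[OF linear_mat_pow_vec] linear_neg[OF linear_mat_pow_vec]

lemma mat_pow_vec_lattice:
  assumes "integer_matrix A" "x \<in> integer_lattice"
  shows "mat_pow_vec A n x \<in> integer_lattice"
  by (induction n) (use assms integer_matrix_mult_lattice in \<open>auto simp: mat_pow_vec_Suc\<close>)

lemma inner_mat_pow_vec_transpose: "mat_pow_vec (transpose A) n x \<bullet> y = x \<bullet> mat_pow_vec A n y"
  by (induction n arbitrary: y)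
    (simp_all add: mat_pow_vec_Suc[of "transpose A"] mat_pow_vec_Suc'[of A] dot_lmul_matrix)

lemma norm_mat_pow_vec:
  assumes "\<And>x. norm (A *v x) = r * norm x"
  shows "norm (mat_pow_vec A n x) = r ^ n * norm x"
  by (induction n) (simp_all add: mat_pow_vec_Suc assms)

lemma eventually_le_power:
  fixes x :: real
  assumes "x > 1"
  shows "eventually (\<lambda>u. y \<le> x ^ u) sequentially"
proof -
  obtain v where "y < x ^ v" using real_arch_pow[OF assms] by blast
  moreover have "x ^ v \<le> x ^ u" if "u \<ge> v" for u using assms that by (intro power_increasing) auto
  ultimately show ?thesis unfolding eventually_sequentially by (meson less_imp_le order_trans)
qed

definition riesz_bounds :: "'a measure \<Rightarrow> 'i set \<Rightarrow> ('i \<Rightarrow> 'a \<Rightarrow> complex) \<Rightarrow> real \<Rightarrow> real \<Rightarrow> bool" where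
  "riesz_bounds M I f C D \<longleftrightarrow> (\<forall>F a. finite F \<longrightarrow> F \<subseteq> I \<longrightarrow>
    C * (\<Sum>k\<in>F. (cmod (a k))\<^sup>2) \<le> (LINT x|M. (cmod (\<Sum>k\<in>F. a k * f k x))\<^sup>2) \<and>
    (LINT x|M. (cmod (\<Sum>k\<in>F. a k * f k x))\<^sup>2) \<le> D * (\<Sum>k\<in>F. (cmod (a k))\<^sup>2))"

section \<open>The similarity, its transpose and the digits\<close>

locale similarity_digits =
  fixes R Q :: "real ^ 'n ^ 'n" and \<rho> :: real and B :: "(real ^ 'n) set"
  assumes rho: "\<rho> > 1" and orth: "orthogonal_matrix Q" and R_eq: "R = \<rho> *\<^sub>R Q"
    and int_R: "integer_matrix R" and fin_B: "finite B" and B_ne: "B \<noteq> {}"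
    and B_lattice: "B \<subseteq> integer_lattice"
    and cosets: "inj_on (\<lambda>b. (+) b ` (*v) R ` integer_lattice) B"
begin

abbreviation "Rp \<equiv> mat_pow_vec R"
abbreviation "Tp \<equiv> mat_pow_vec (transpose R)"
abbreviation "Ip \<equiv> mat_pow_vec (matrix_inv R)"

lemma rho_pos: "\<rho> > 0" using rho by simp

lemma norm_R: "norm (R *v x) = \<rho> * norm x"
  and norm_RT: "norm (transpose R *v x) = \<rho> * norm x"
proof -
  have *: "norm (M *v x) = norm x" if "orthogonal_matrix M" for M :: "real^'n^'n" and x
  proof -
    have "orthogonal_transformation ((*v) M)"
      using that by (simp add: orthogonal_transformation_matrix)
    then show ?thesis by (simp add: orthogonal_transformation)
  qed
  show "norm (R *v x) = \<rho> * norm x"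
    using *[OF orth] rho by (simp add: R_eq flip: scaleR_matrix_vector_assoc)
  have "transpose R = \<rho> *\<^sub>R transpose Q"
    by (simp add: R_eq transpose_def vec_eq_iff)
  then show "norm (transpose R *v x) = \<rho> * norm x"
    using *[of "transpose Q"] orth rho by (simp flip: scaleR_matrix_vector_assoc)
qed

lemma invertible_R: "invertible R" and invertible_RT: "invertible (transpose R)"
proof -
  have "inj ((*v) R)"
  proof (rule injI)
    fix x y assume "R *v x = R *v y"
    then have "norm (R *v (x - y)) = 0" by (simp add: matrix_vector_mult_diff_distrib)
    then show "x = y" using rho_pos by (simp add: norm_R)
  qed
  then show "invertible R"
    by (simp add: invertible_left_inverse matrix_left_invertible_injective)
  then show "invertible (transpose R)" by (simp add: transpose_invertible)
qed

lemma R_inv [simp]: "R *v (matrix_inv R *v x) = x" "matrix_inv R *v (R *v x) = x"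
proof -
  have "R ** matrix_inv R = mat 1 \<and> matrix_inv R ** R = mat 1"
    using invertible_R unfolding invertible_def matrix_inv_def by (rule someI_ex)
  then show "R *v (matrix_inv R *v x) = x" "matrix_inv R *v (R *v x) = x"
    by (simp_all add: matrix_vector_mul_assoc)
qed

lemma Rp_Ip [simp]: "Rp n (Ip n x) = x"
  by (induction n arbitrary: x) (simp_all add: mat_pow_vec_Suc[of "matrix_inv R"] mat_pow_vec_Suc'[of R])

lemma norm_Tp: "norm (Tp n x) = \<rho> ^ n * norm x"
  by (rule norm_mat_pow_vec[OF norm_RT])

lemma norm_Rp: "norm (Rp n x) = \<rho> ^ n * norm x"
  by (rule norm_mat_pow_vec[OF norm_R])

lemma norm_Ip: "norm (Ip n x) = norm x / \<rho> ^ n"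
  using norm_Rp[of n "Ip n x"] rho_pos by (simp add: field_simps)

lemma Tp_inj: "Tp n x = Tp n y \<longleftrightarrow> x = y"
proof
  assume "Tp n x = Tp n y"
  then have "norm (Tp n (x - y)) = 0" by simp
  then show "x = y" using rho_pos by (simp add: norm_Tp del: mat_pow_vec_linear_simps)
qed simp

lemma Tp_surj: "\<exists>z. Tp n z = x"
proof (induction n arbitrary: x)
  case (Suc n)
  have "surj ((*v) (transpose R))"
    using invertible_RT by (simp add: invertible_right_inverse matrix_right_invertible_surjective)
  then obtain y where "x = transpose R *v y" by (auto simp: surj_def)
  with Suc[of y] show ?case by (auto simp: mat_pow_vec_Suc)
qed simp

lemma int_RT: "integer_matrix (transpose R)"
  using int_R by (simp add: integer_matrix_def transpose_def)

lemma Tp_lattice: "x \<in> integer_lattice \<Longrightarrow> Tp n x \<in> integer_lattice"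
  by (rule mat_pow_vec_lattice[OF int_RT])

lemma Rp_lattice: "x \<in> integer_lattice \<Longrightarrow> Rp n x \<in> integer_lattice"
  by (rule mat_pow_vec_lattice[OF int_R])

lemma exponential_Tp: "exponential (Tp n l) x = exponential l (Rp n x)"
  by (simp add: exponential_def inner_mat_pow_vec_transpose)

lemma exponential_Tp_lattice:
  "l \<in> integer_lattice \<Longrightarrow> Rp n x \<in> integer_lattice \<Longrightarrow> exponential (Tp n l) x = 1"
  by (simp add: exponential_eq_1_iff inner_mat_pow_vec_transpose inner_integer_lattice)

lemma digits_distinct:
  assumes "b \<in> B" "b' \<in> B" "z \<in> integer_lattice" "b - b' = R *v z"
  shows "b = b'"
proof (rule inj_onD[OF cosets _ assms(1,2)])
  have *: "(+) c ` (*v) R ` integer_lattice \<subseteq> (+) c' ` (*v) R ` integer_lattice"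
    if "c - c' = R *v w" "w \<in> integer_lattice" for c c' w
  proof clarify
    fix u :: "real^'n" assume "u \<in> integer_lattice"
    moreover have "c + R *v u = c' + R *v (w + u)"
      using that by (simp add: matrix_vector_right_distrib algebra_simps)
    ultimately show "c + R *v u \<in> (+) c' ` (*v) R ` integer_lattice"
      using that integer_lattice_closed by blast
  qed
  have "b' - b = R *v (0 - z)"
    unfolding matrix_vector_mult_diff_distrib assms(4)[symmetric] by simp
  with * assms(3,4) integer_lattice_closed
  show "(+) b ` (*v) R ` integer_lattice = (+) b' ` (*v) R ` integer_lattice"
    by (intro equalityI) blast+
qed

text \<open>The points \<open>\<tau>\<^sub>w(0)\<close> for words \<open>w\<close> of length \<open>n\<close>.\<close>

fun level_points :: "nat \<Rightarrow> (real ^ 'n) set" where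
  "level_points 0 = {0}"
| "level_points (Suc n) = (\<Union>b\<in>B. ifs_map R b ` level_points n)"

lemma R_ifs_map [simp]: "R *v ifs_map R b x = x + b"
  by (simp add: ifs_map_def)

lemma Rp_level_points: "x \<in> level_points n \<Longrightarrow> Rp n x \<in> integer_lattice"
proof (induction n arbitrary: x)
  case (Suc n)
  then obtain b y where b: "b \<in> B" "y \<in> level_points n" "x = ifs_map R b y" by auto
  then have "Rp (Suc n) x = Rp n y + Rp n b" by (simp add: mat_pow_vec_Suc')
  moreover have "Rp n b \<in> integer_lattice" using b B_lattice Rp_lattice by blast
  ultimately show ?case using Suc.IH[OF b(2)] integer_lattice_closed(2) by metis
qed (simp add: integer_lattice_closed)

text \<open>\<open>R\<close> strips off one letter: it sends the difference to
  \<open>(x - x') + (b - b')\<close>. The digits lie in the lattice, so \<open>x - x'\<close> does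
  too and \<open>x = x'\<close>; then the two digits are congruent modulo the image of the lattice
  under \<open>R\<close>.\<close>

lemma ifs_map_level_points_distinct:
  assumes IH: "\<And>x x'. x \<in> X \<Longrightarrow> x' \<in> X \<Longrightarrow> x - x' \<in> integer_lattice \<Longrightarrow> x = x'"
    and "b \<in> B" "b' \<in> B" "x \<in> X" "x' \<in> X" "ifs_map R b x - ifs_map R b' x' \<in> integer_lattice"
  shows "b = b' \<and> x = x'"
proof -
  have eq: "R *v (ifs_map R b x - ifs_map R b' x') = (x - x') + (b - b')"
    by (simp add: matrix_vector_mult_diff_distrib)
  then have "(x - x') + (b - b') \<in> integer_lattice"
    using integer_matrix_mult_lattice[OF int_R assms(6)] by simp
  moreover have "b - b' \<in> integer_lattice"
    using assms B_lattice by (intro integer_lattice_closed) auto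
  ultimately have "(x - x') + (b - b') - (b - b') \<in> integer_lattice"
    by (rule integer_lattice_closed)
  then have x: "x = x'" using IH assms by simp
  with eq have "b - b' = R *v (ifs_map R b x - ifs_map R b' x')" by simp
  with digits_distinct assms x show ?thesis by blast
qed

lemma level_points_distinct:
  "x \<in> level_points n \<Longrightarrow> x' \<in> level_points n \<Longrightarrow> x - x' \<in> integer_lattice \<Longrightarrow> x = x'"
proof (induction n arbitrary: x x')
  case (Suc n)
  then obtain b y b' y' where "b \<in> B" "b' \<in> B" "y \<in> level_points n" "y' \<in> level_points n"
    "x = ifs_map R b y" "x' = ifs_map R b' y'" by auto
  with ifs_map_level_points_distinct[of "level_points n" b b' y y'] Suc show ?case by blast
qed simp

lemma finite_level_points [simp]: "finite (level_points n)"
  by (induction n) (auto simp: fin_B)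

lemma sum_level_points_Suc:
  "(\<Sum>x\<in>level_points (Suc n). g x) = (\<Sum>b\<in>B. \<Sum>x\<in>level_points n. g (ifs_map R b x))"
proof -
  have inj: "inj_on (\<lambda>(b, x). ifs_map R b x) (B \<times> level_points n)"
  proof (rule inj_onI, clarify)
    fix b x b' x' assume A: "b \<in> B" "x \<in> level_points n" "b' \<in> B" "x' \<in> level_points n"
      and "ifs_map R b x = ifs_map R b' x'"
    then have "ifs_map R b x - ifs_map R b' x' \<in> integer_lattice"
      by (simp add: integer_lattice_closed)
    from ifs_map_level_points_distinct[OF level_points_distinct A(1,3,2,4) this]
    show "b = b' \<and> x = x'" .
  qed
  have "(\<Sum>x\<in>level_points (Suc n). g x) = sum g ((\<lambda>(b, x). ifs_map R b x) ` (B \<times> level_points n))"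
    by (rule arg_cong[of _ _ "sum g"]) auto
  also have "\<dots> = (\<Sum>(b, x)\<in>B \<times> level_points n. g (ifs_map R b x))"
    by (subst sum.reindex[OF inj]) (simp add: case_prod_unfold)
  finally show ?thesis by (simp add: sum.cartesian_product)
qed

lemma card_level_points: "card (level_points n) = card B ^ n"
proof (induction n)
  case (Suc n)
  then show ?case
    using sum_level_points_Suc[of "\<lambda>_. 1::nat" n] by simp
qed simp

section \<open>Averages over the points of one level\<close>

lemma card_B_pos: "card B > 0"
  using fin_B B_ne by (simp add: card_gt_0_iff)

text \<open>Integration against the \<open>n\<close>-th partial convolution of the self-similar
  measure.\<close>

definition avg :: "nat \<Rightarrow> (real ^ 'n \<Rightarrow> real) \<Rightarrow> real" where
  "avg n g = (\<Sum>x\<in>level_points n. g x) / real (card B) ^ n"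

lemma avg_Suc: "avg (Suc n) g = (\<Sum>b\<in>B. avg n (\<lambda>x. g (ifs_map R b x))) / card B"
  unfolding avg_def sum_level_points_Suc by (simp add: sum_divide_distrib mult.commute)

lemma ifs_map_add_Ip: "ifs_map R b (x + Ip n y) = ifs_map R b x + Ip (Suc n) y"
  by (simp add: ifs_map_def mat_pow_vec_Suc matrix_vector_right_distrib algebra_simps)

text \<open>A word of length \<open>m + n\<close> is a word of length \<open>m\<close> followed by
  one of length \<open>n\<close>, whose point is contracted by \<open>Ip m\<close>; the partial
  convolution factors accordingly.\<close>

lemma avg_add: "avg (m + n) g = avg m (\<lambda>x. avg n (\<lambda>y. g (x + Ip m y)))"
proof (induction m arbitrary: g)
  case 0
  show ?case by (simp add: avg_def)
next
  case (Suc m)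
  show ?case
    by (simp only: add_Suc avg_Suc Suc ifs_map_add_Ip)
qed

lemma avg_mono: "(\<And>x. x \<in> level_points n \<Longrightarrow> g x \<le> g' x) \<Longrightarrow> avg n g \<le> avg n g'"
  unfolding avg_def using card_B_pos by (intro divide_right_mono sum_mono) auto

lemma avg_cong: "(\<And>x. x \<in> level_points n \<Longrightarrow> g x = g' x) \<Longrightarrow> avg n g = avg n g'"
  unfolding avg_def by (intro arg_cong2[of _ _ _ _ "(/)"] sum.cong) auto

lemma avg_sum: "avg n (\<lambda>x. \<Sum>i\<in>I. g i x) = (\<Sum>i\<in>I. avg n (g i))"
  unfolding avg_def by (simp only: sum_divide_distrib) (rule sum.swap)

lemma avg_cmult: "avg n (\<lambda>x. c * g x) = c * avg n g"
  unfolding avg_def by (simp add: sum_distrib_left)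

text \<open>Representatives of the integer lattice modulo its image under \<open>(R\<^sup>T) ^ n\<close>.\<close>

definition frequencies :: "nat \<Rightarrow> (real ^ 'n) set" where
  "frequencies n = {Tp n z | z. Tp n z \<in> integer_lattice \<and> (\<forall>i. 0 \<le> z $ i \<and> z $ i < 1)}"

lemma frequencies_lattice: "frequencies n \<subseteq> integer_lattice"
  by (auto simp: frequencies_def)

lemma norm_frequencies: "l \<in> frequencies n \<Longrightarrow> norm l \<le> \<rho> ^ n * CARD('n)"
proof -
  assume "l \<in> frequencies n"
  then obtain z where z: "l = Tp n z" "\<And>i. 0 \<le> z $ i \<and> z $ i < 1" by (auto simp: frequencies_def)
  have "norm z \<le> (\<Sum>i\<in>UNIV. \<bar>z $ i\<bar>)" by (rule norm_le_l1_cart)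
  also have "\<dots> \<le> (\<Sum>i\<in>(UNIV::'n set). 1)" using z(2) by (intro sum_mono) (simp add: less_imp_le)
  finally show ?thesis using rho_pos by (simp add: z norm_Tp)
qed

lemma finite_frequencies: "finite (frequencies n)"
  by (rule finite_subset[OF _ finite_integer_lattice_bounded[of "\<rho> ^ n * CARD('n)"]])
    (use frequencies_lattice norm_frequencies in auto)

lemma zero_in_frequencies: "0 \<in> frequencies n"
  unfolding frequencies_def by (auto intro!: exI[of _ 0] simp: integer_lattice_closed)

lemma frequencies_distinct:
  assumes "l \<in> frequencies n" "l' \<in> frequencies n" "w \<in> integer_lattice" "l - l' = Tp n w"
  shows "l = l'"
proof -
  obtain z where z: "l = Tp n z" "\<And>i. 0 \<le> z $ i \<and> z $ i < 1"
    using assms by (auto simp: frequencies_def)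
  obtain z' where z': "l' = Tp n z'" "\<And>i. 0 \<le> z' $ i \<and> z' $ i < 1"
    using assms by (auto simp: frequencies_def)
  have "Tp n (z - z') = Tp n w" using assms z z' by simp
  then have w: "z - z' = w" by (simp only: Tp_inj)
  have "z $ i = z' $ i" for i
  proof -
    have "z $ i - z' $ i \<in> \<int>"
      using w assms(3) by (auto simp: integer_lattice_def)
    moreover have "\<bar>z $ i - z' $ i\<bar> < 1" using z(2)[of i] z'(2)[of i] by linarith
    ultimately show ?thesis using Ints_nonzero_abs_less1 by fastforce
  qed
  then have "z = z'" by (simp add: vec_eq_iff)
  then show ?thesis by (simp add: z z')
qed

lemma frequencies_representative:
  assumes "l \<in> integer_lattice"
  shows "\<exists>l'\<in>frequencies n. \<exists>w\<in>integer_lattice. l = l' + Tp n w"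
proof -
  obtain z where z: "Tp n z = l" using Tp_surj by blast
  define w :: "real ^ 'n" where "w = (\<chi> i. of_int \<lfloor>z $ i\<rfloor>)"
  have w: "w \<in> integer_lattice" by (simp add: w_def integer_lattice_def)
  have "Tp n (z - w) \<in> integer_lattice"
    using assms z w Tp_lattice by (auto intro: integer_lattice_closed)
  then have "Tp n (z - w) \<in> frequencies n"
    unfolding frequencies_def by (auto simp: w_def intro!: exI[of _ "z - w"]) linarith
  with w z show ?thesis by (intro bexI[of _ "Tp n (z - w)"] bexI[of _ w]) auto
qed

text \<open>Shifting by a unit vector permutes \<open>frequencies n\<close> modulo the kernel of the character
  \<open>x\<close>, and multiplies the character sum by a number different from 1.\<close>

lemma sum_exponential_frequencies:
  assumes "Rp n x \<in> integer_lattice" "x \<notin> integer_lattice"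
  shows "(\<Sum>l\<in>frequencies n. exponential l x) = 0"
proof -
  obtain i where i: "x $ i \<notin> \<int>" using assms(2) by (auto simp: integer_lattice_def)
  define a :: "real ^ 'n" where "a = axis i 1"
  have "a \<bullet> x = x $ i" by (simp add: a_def inner_axis' )
  then have a: "exponential a x \<noteq> 1" using i by (simp add: exponential_eq_1_iff)
  have "\<forall>l\<in>frequencies n. \<exists>l'. l' \<in> frequencies n \<and> (\<exists>w\<in>integer_lattice. l + a = l' + Tp n w)"
    using frequencies_representative frequencies_lattice integer_lattice_closed(2,4)
    unfolding a_def by blast
  then obtain \<sigma> where \<sigma>: "\<forall>l\<in>frequencies n. \<sigma> l \<in> frequencies n \<and> (\<exists>w\<in>integer_lattice. l + a = \<sigma> l + Tp n w)"
    by (rule bchoice[THEN exE])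
  have inj: "inj_on \<sigma> (frequencies n)"
  proof (rule inj_onI)
    fix l l' assume l: "l \<in> frequencies n" "l' \<in> frequencies n" and eq: "\<sigma> l = \<sigma> l'"
    obtain w w' where w: "w \<in> integer_lattice" "w' \<in> integer_lattice"
      "l + a = \<sigma> l + Tp n w" "l' + a = \<sigma> l' + Tp n w'" using \<sigma> l by meson
    have "l - l' = (l + a) - (l' + a)" by simp
    also have "\<dots> = Tp n (w - w')" unfolding w(3,4) using eq by simp
    finally show "l = l'" using frequencies_distinct l w integer_lattice_closed(3) by blast
  qed
  have im: "\<sigma> ` frequencies n = frequencies n"
    using inj \<sigma> finite_frequencies by (intro endo_inj_surj) auto
  have e: "exponential (\<sigma> l) x = exponential l x * exponential a x" if l: "l \<in> frequencies n" for l
  proof -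
    obtain w where w: "w \<in> integer_lattice" "l + a = \<sigma> l + Tp n w" using \<sigma> l by meson
    have "exponential l x * exponential a x = exponential (\<sigma> l + Tp n w) x"
      by (simp only: exponential_add_left w(2)[symmetric])
    also have "\<dots> = exponential (\<sigma> l) x"
      using exponential_Tp_lattice[OF w(1) assms(1)] by (simp add: exponential_add_left)
    finally show ?thesis by simp
  qed
  have "(\<Sum>l\<in>frequencies n. exponential l x) = (\<Sum>l\<in>frequencies n. exponential (\<sigma> l) x)"
    using sum.reindex[OF inj, of "\<lambda>l. exponential l x"] by (simp add: im)
  also have "\<dots> = (\<Sum>l\<in>frequencies n. exponential l x) * exponential a x"
    by (simp add: e sum_distrib_right)
  finally show ?thesis using a by (metis mult_cancel_left1)
qed

section \<open>Tightness of the character Gram matrices\<close>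

definition gram :: "nat \<Rightarrow> real ^ 'n \<Rightarrow> real ^ 'n \<Rightarrow> complex" where
  "gram n a b = (\<Sum>x\<in>level_points n. exponential (a - b) x) / of_real (real (card B) ^ n)"

text \<open>The characters are vectors in the space of functions on \<open>level_points n\<close>,
  whose dimension is the number of points. Since distinct points differ by more than a lattice
  vector, the sum over \<open>frequencies n\<close> of the characters at \<open>y - x\<close>
  vanishes unless \<open>x = y\<close>.\<close>

lemma gram_tight: "tight_gram (frequencies n) (gram n) (real (card B) ^ n)"
proof
  let ?s = "real (card B) ^ n"
  show "finite (frequencies n)" by (rule finite_frequencies)
  show "frequencies n \<noteq> {}" using zero_in_frequencies by blast
  show "?s > 0" using card_B_pos by simp
  show "gram n a a = 1" for a
    using card_B_pos by (simp add: gram_def card_level_points)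
  show "cnj (gram n a b) = gram n b a" for a b
    by (simp add: gram_def cnj_exponential)
  show "(\<Sum>e\<in>frequencies n. gram n a e * gram n e b)
      = of_real (real (card (frequencies n)) / ?s) * gram n a b" for a b
  proof -
    have "(\<Sum>e\<in>frequencies n. exponential (a - e) x * exponential (e - b) y)
        = (if x = y then of_nat (card (frequencies n)) * exponential (a - b) x else 0)"
      if xy: "x \<in> level_points n" "y \<in> level_points n" for x y
    proof -
      have "exponential (a - e) x * exponential (e - b) y
          = exponential a x * exponential (- b) y * exponential e (y - x)" for e
        unfolding diff_conv_add_uminus exponential_add_left exponential_add_right
          exponential_uminus_right by (simp only: mult_ac)
      then have "(\<Sum>e\<in>frequencies n. exponential (a - e) x * exponential (e - b) y)
          = exponential a x * exponential (- b) y * (\<Sum>e\<in>frequencies n. exponential e (y - x))"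
        by (simp only: sum_distrib_left)
      also have "\<dots> = (if x = y then of_nat (card (frequencies n)) * exponential (a - b) x else 0)"
      proof (cases "x = y")
        case True
        have "exponential a x * exponential (- b) x = exponential (a - b) x"
          by (simp only: diff_conv_add_uminus exponential_add_left)
        with True show ?thesis by simp
      next
        case False
        have "y - x \<notin> integer_lattice" using level_points_distinct[OF xy(2,1)] False by blast
        moreover have "Rp n (y - x) \<in> integer_lattice"
          using xy Rp_level_points by (simp add: integer_lattice_closed)
        ultimately show ?thesis using False sum_exponential_frequencies by simp
      qed
      finally show ?thesis .
    qed
    note inner = this
    have "(\<Sum>e\<in>frequencies n. gram n a e * gram n e b) = (\<Sum>e\<in>frequencies n.
        (\<Sum>x\<in>level_points n. \<Sum>y\<in>level_points n. exponential (a - e) x * exponential (e - b) y))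
        / (of_real ?s * of_real ?s)"
      by (simp only: gram_def times_divide_times_eq sum_product sum_divide_distrib)
    also have "(\<Sum>e\<in>frequencies n.
        (\<Sum>x\<in>level_points n. \<Sum>y\<in>level_points n. exponential (a - e) x * exponential (e - b) y))
      = (\<Sum>x\<in>level_points n. \<Sum>e\<in>frequencies n. \<Sum>y\<in>level_points n. exponential (a - e) x * exponential (e - b) y)"
      by (rule sum.swap)
    also have "\<dots> = (\<Sum>x\<in>level_points n. \<Sum>y\<in>level_points n. \<Sum>e\<in>frequencies n. exponential (a - e) x * exponential (e - b) y)"
      by (intro sum.cong refl sum.swap)
    also have "\<dots> = (\<Sum>x\<in>level_points n. \<Sum>y\<in>level_points n.
        if x = y then of_nat (card (frequencies n)) * exponential (a - b) x else 0)"
      by (intro sum.cong refl) (simp only: inner)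
    also have "\<dots> = of_nat (card (frequencies n)) * (\<Sum>x\<in>level_points n. exponential (a - b) x)"
      by (simp add: sum_distrib_left)
    finally show ?thesis by (simp add: gram_def)
  qed
qed

section \<open>Well-conditioned sets of frequencies\<close>

text \<open>Riesz bounds for the uniform measure on \<open>level_points n\<close> in place of the
  self-similar measure.\<close>

definition well_conditioned :: "nat \<Rightarrow> (real ^ 'n) set \<Rightarrow> real \<Rightarrow> real \<Rightarrow> bool" where
  "well_conditioned n L \<alpha> \<beta> \<longleftrightarrow> (\<forall>c. \<alpha> * (\<Sum>l\<in>L. (cmod (c l))\<^sup>2)
      \<le> avg n (\<lambda>x. (cmod (\<Sum>l\<in>L. c l * exponential l x))\<^sup>2) \<and>
    avg n (\<lambda>x. (cmod (\<Sum>l\<in>L. c l * exponential l x))\<^sup>2) \<le> \<beta> * (\<Sum>l\<in>L. (cmod (c l))\<^sup>2))"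

lemma avg_norm_square_eq_gram:
  "of_real (avg n (\<lambda>x. (cmod (\<Sum>l\<in>L. c l * exponential l x))\<^sup>2))
    = (\<Sum>a\<in>L. \<Sum>b\<in>L. c a * gram n a b * cnj (c b))"
proof -
  let ?s = "complex_of_real (real (card B) ^ n)"
  have sq: "of_real ((cmod (\<Sum>l\<in>L. c l * exponential l x))\<^sup>2)
      = (\<Sum>a\<in>L. \<Sum>b\<in>L. c a * cnj (c b) * exponential (a - b) x)" for x
    unfolding complex_norm_square cnj_sum complex_cnj_mult cnj_exponential sum_product
      diff_conv_add_uminus exponential_add_left
    by (intro sum.cong refl) (simp only: mult_ac)
  have "of_real (avg n (\<lambda>x. (cmod (\<Sum>l\<in>L. c l * exponential l x))\<^sup>2))
      = (\<Sum>x\<in>level_points n. \<Sum>a\<in>L. \<Sum>b\<in>L. c a * cnj (c b) * exponential (a - b) x) / ?s"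
    unfolding avg_def of_real_divide of_real_sum sq ..
  also have "(\<Sum>x\<in>level_points n. \<Sum>a\<in>L. \<Sum>b\<in>L. c a * cnj (c b) * exponential (a - b) x)
      = (\<Sum>a\<in>L. \<Sum>x\<in>level_points n. \<Sum>b\<in>L. c a * cnj (c b) * exponential (a - b) x)"
    by (rule sum.swap)
  also have "\<dots> = (\<Sum>a\<in>L. \<Sum>b\<in>L. \<Sum>x\<in>level_points n. c a * cnj (c b) * exponential (a - b) x)"
    by (intro sum.cong refl sum.swap)
  also have "\<dots> / ?s = (\<Sum>a\<in>L. \<Sum>b\<in>L. c a * gram n a b * cnj (c b))"
    unfolding sum_divide_distrib[of _ L] gram_def
    by (intro sum.cong refl) (simp add: sum_distrib_left[symmetric])
  finally show ?thesis .
qed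

lemma well_conditioned_subset_frequencies:
  assumes "p \<ge> 1" and k: "2 * real k \<le> real (card B) ^ n" and \<epsilon>: "0 < \<epsilon>" "\<epsilon> \<le> 1"
    and small: "walk_const p p * k * (k / real (card B) ^ n) ^ p \<le> \<epsilon> ^ (2 * p)"
  shows "\<exists>L\<subseteq>frequencies n. card L = k \<and> well_conditioned n L (1 - \<epsilon>) (1 + \<epsilon>)"
proof -
  interpret tight_gram "frequencies n" "gram n" "real (card B) ^ n" by (rule gram_tight)
  from exists_well_conditioned_subset[OF \<open>p \<ge> 1\<close> k \<epsilon> small]
  obtain L where L: "L \<subseteq> frequencies n \<and> card L = k \<and> (\<forall>f. cmod ((\<Sum>a\<in>L. \<Sum>b\<in>L. cnj (f a) * gram n a b * f b) -
     of_real (\<Sum>a\<in>L. (cmod (f a))\<^sup>2)) \<le> \<epsilon> * (\<Sum>a\<in>L. (cmod (f a))\<^sup>2))" ..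
  then have bd: "\<And>f. cmod ((\<Sum>a\<in>L. \<Sum>b\<in>L. cnj (f a) * gram n a b * f b) -
     of_real (\<Sum>a\<in>L. (cmod (f a))\<^sup>2)) \<le> \<epsilon> * (\<Sum>a\<in>L. (cmod (f a))\<^sup>2)" by simp
  have "well_conditioned n L (1 - \<epsilon>) (1 + \<epsilon>)"
    unfolding well_conditioned_def
  proof
    fix c :: "real ^ 'n \<Rightarrow> complex"
    let ?A = "avg n (\<lambda>x. (cmod (\<Sum>l\<in>L. c l * exponential l x))\<^sup>2)"
    let ?C = "\<Sum>l\<in>L. (cmod (c l))\<^sup>2"
    have "\<bar>?A - ?C\<bar> = cmod (of_real ?A - of_real ?C)"
      by (simp only: of_real_diff[symmetric] norm_of_real)
    \<comment> \<open>The two quadratic forms carry the conjugation on opposite sides, hence the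
      conjugated coefficients.\<close>
    also have "\<dots> \<le> \<epsilon> * ?C"
      using bd[of "\<lambda>l. cnj (c l)"] unfolding avg_norm_square_eq_gram by simp
    finally show "(1 - \<epsilon>) * ?C \<le> ?A \<and> ?A \<le> (1 + \<epsilon>) * ?C"
      by (simp add: algebra_simps abs_le_iff)
  qed
  with L show ?thesis by blast
qed

text \<open>Translation multiplies every sum by a character of modulus 1. It serves to move one of
  the frequencies to 0.\<close>

lemma well_conditioned_translate:
  assumes "well_conditioned n L \<alpha> \<beta>"
  shows "well_conditioned n ((\<lambda>l. l - a) ` L) \<alpha> \<beta>"
  unfolding well_conditioned_def
proof
  fix c :: "real ^ 'n \<Rightarrow> complex"
  let ?L = "(\<lambda>l. l - a) ` L"
  have inj: "inj_on (\<lambda>l. l - a) L" by (simp add: inj_on_def)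
  have "cmod (\<Sum>l\<in>?L. c l * exponential l x) = cmod (\<Sum>l\<in>L. c (l - a) * exponential l x)" for x
  proof -
    have "(\<Sum>l\<in>?L. c l * exponential l x) = (\<Sum>l\<in>L. c (l - a) * exponential l x) * exponential (- a) x"
      unfolding sum.reindex[OF inj] o_def sum_distrib_right
      by (simp only: diff_conv_add_uminus exponential_add_left mult.assoc)
    then show ?thesis by (simp add: norm_mult)
  qed
  moreover have "(\<Sum>l\<in>?L. (cmod (c l))\<^sup>2) = (\<Sum>l\<in>L. (cmod (c (l - a)))\<^sup>2)"
    by (simp add: sum.reindex[OF inj] o_def)
  ultimately show "\<alpha> * (\<Sum>l\<in>?L. (cmod (c l))\<^sup>2)
      \<le> avg n (\<lambda>x. (cmod (\<Sum>l\<in>?L. c l * exponential l x))\<^sup>2) \<and>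
    avg n (\<lambda>x. (cmod (\<Sum>l\<in>?L. c l * exponential l x))\<^sup>2) \<le> \<beta> * (\<Sum>l\<in>?L. (cmod (c l))\<^sup>2)"
    using assms[unfolded well_conditioned_def, rule_format, of "\<lambda>l. c (l - a)"] by simp
qed

lemma well_conditioned_zero: "well_conditioned n {0} 1 1"
  using card_B_pos by (simp add: well_conditioned_def avg_def card_level_points)

definition sim_dim :: real where "sim_dim = log \<rho> (card B)"

lemma sim_dim_nonneg: "sim_dim \<ge> 0"
  using rho card_B_pos by (simp add: sim_dim_def Suc_le_eq)

lemma rho_power_powr_sim_dim: "(\<rho> ^ j) powr (\<gamma> * sim_dim) = (real (card B) powr \<gamma>) ^ j"
proof -
  have "(\<rho> ^ j) powr (\<gamma> * sim_dim) = ((\<rho> powr sim_dim) powr \<gamma>) powr j"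
    using rho by (simp add: powr_powr mult_ac flip: powr_realpow)
  also have "\<rho> powr sim_dim = card B"
    using rho card_B_pos by (simp add: sim_dim_def)
  finally show ?thesis using card_B_pos by (simp add: powr_realpow)
qed

text \<open>With \<open>N = card B\<close>, the level is \<open>n = p * u\<close> and the block has
  \<open>k = N ^ ((p - 1) * u)\<close> elements. Then
  \<open>k * (k / N ^ n) ^ p = 1 / N ^ u\<close>, which for large \<open>u\<close> absorbs
  \<open>walk_const p p / \<epsilon> ^ (2 * p)\<close>. The shift \<open>m\<close> is fixed before
  \<open>u\<close> is chosen and costs only a constant factor in the radius.\<close>

lemma exists_block:
  fixes H :: real
  assumes \<epsilon>: "0 < \<epsilon>" "\<epsilon> \<le> 1" and \<gamma>: "0 \<le> \<gamma>" "\<gamma> < 1"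
  shows "\<exists>n L h. finite L \<and> L \<subseteq> integer_lattice \<and> 0 \<in> L \<and> well_conditioned n L (1 - \<epsilon>) (1 + \<epsilon>) \<and>
    h \<ge> H \<and> (\<forall>l\<in>L. norm (Tp m l) < h) \<and> h powr (\<gamma> * sim_dim) \<le> card L"
proof -
  \<comment> \<open>Two elements of \<open>frequencies n\<close> differ by at most
    \<open>2 * CARD('n) * \<rho> ^ n\<close> in norm; the additional 1 makes the inequality strict,
    as balls are open.\<close>
  define K where "K = 2 * real CARD('n) + 1"
  have K: "K \<ge> 1" by (simp add: K_def)
  show ?thesis
  \<comment> \<open>For a single digit the powers of \<open>card B\<close> do not grow, but the
    dimension is 0 and one frequency is enough.\<close>
  proof (cases "card B = 1")
    case True
    obtain n where n: "H \<le> \<rho> ^ n"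
      using eventually_le_power[OF rho, of H] by (auto simp: eventually_sequentially)
    have "well_conditioned n {0} (1 - \<epsilon>) (1 + \<epsilon>)"
      unfolding well_conditioned_def
    proof
      fix c :: "real ^ 'n \<Rightarrow> complex"
      have "(1 - \<epsilon>) * (cmod (c 0))\<^sup>2 \<le> 1 * (cmod (c 0))\<^sup>2" "1 * (cmod (c 0))\<^sup>2 \<le> (1 + \<epsilon>) * (cmod (c 0))\<^sup>2"
        using \<epsilon> by (intro mult_right_mono; simp)+
      then show "(1 - \<epsilon>) * (\<Sum>l\<in>{0}. (cmod (c l))\<^sup>2)
          \<le> avg n (\<lambda>x. (cmod (\<Sum>l\<in>{0}. c l * exponential l x))\<^sup>2) \<and>
        avg n (\<lambda>x. (cmod (\<Sum>l\<in>{0}. c l * exponential l x))\<^sup>2) \<le> (1 + \<epsilon>) * (\<Sum>l\<in>{0}. (cmod (c l))\<^sup>2)"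
        using well_conditioned_zero[of n, unfolded well_conditioned_def, rule_format, of c] by auto
    qed
    moreover have "sim_dim = 0" using True by (simp add: sim_dim_def)
    moreover have "\<rho> ^ n > 0" using rho_pos by simp
    ultimately show ?thesis
      using n by (intro exI[of _ n] exI[of _ "{0}"] exI[of _ "\<rho> ^ n"]) (simp add: integer_lattice_closed)
  next
    case False
    then have N: "real (card B) \<ge> 2" using card_B_pos by linarith
    \<comment> \<open>This choice makes \<open>1 - 1/p\<close> larger than \<open>\<gamma>\<close>.
      The surplus \<open>\<delta>\<close> outgrows the factor \<open>C\<close>, which collects what
      \<open>K\<close> and \<open>m\<close> contribute to
      \<open>h powr (\<gamma> * sim_dim)\<close>.\<close>
    define p where "p = nat \<lceil>1 / (1 - \<gamma>)\<rceil> + 1"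
    have p: "p \<ge> 1" "real p - 1 - \<gamma> * real p > 0"
    proof -
      have "1 / (1 - \<gamma>) < real p" unfolding p_def by linarith
      then show "real p - 1 - \<gamma> * real p > 0" using \<gamma> by (simp add: field_simps)
    qed (simp add: p_def)
    define \<delta> where "\<delta> = real p - 1 - \<gamma> * real p"
    have \<delta>: "\<delta> > 0" using p by (simp add: \<delta>_def)
    define C where "C = K powr (\<gamma> * sim_dim) * (real (card B) powr \<gamma>) ^ m"
    have "eventually (\<lambda>u. walk_const p p / \<epsilon> ^ (2 * p) \<le> real (card B) ^ u) sequentially"
      using N by (intro eventually_le_power) simp
    moreover have "eventually (\<lambda>u. H \<le> \<rho> ^ u) sequentially"
      by (rule eventually_le_power[OF rho])
    moreover have "eventually (\<lambda>u. C \<le> (real (card B) powr \<delta>) ^ u) sequentially"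
      using N \<delta> by (intro eventually_le_power) simp
    moreover have "eventually (\<lambda>u. u \<ge> 1) sequentially" by (rule eventually_ge_at_top)
    ultimately have "eventually (\<lambda>u. walk_const p p / \<epsilon> ^ (2 * p) \<le> real (card B) ^ u \<and> H \<le> \<rho> ^ u \<and>
      C \<le> (real (card B) powr \<delta>) ^ u \<and> u \<ge> 1) sequentially" by eventually_elim simp
    then obtain u where u: "walk_const p p / \<epsilon> ^ (2 * p) \<le> real (card B) ^ u" "H \<le> \<rho> ^ u"
      "C \<le> (real (card B) powr \<delta>) ^ u" "u \<ge> 1" by (auto simp: eventually_sequentially)
    define n where "n = p * u"
    define k where "k = card B ^ ((p - 1) * u)"
    have n: "n = (p - 1) * u + u" using p(1) by (simp add: n_def algebra_simps)
    have s: "real (card B) ^ n = real k * real (card B) ^ u" by (simp add: n k_def power_add)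
    have kpos: "real k > 0" using card_B_pos by (simp add: k_def)
    have "2 \<le> real (card B) ^ u"
      using N self_le_power[of "real (card B)" u] u(4) by linarith
    then have k2: "2 * real k \<le> real (card B) ^ n"
      using kpos unfolding s by (simp add: mult.commute)
    have ks: "real k * (k / real (card B) ^ n) ^ p = 1 / real (card B) ^ u"
    proof -
      have "(k / real (card B) ^ n) ^ p = 1 / real (card B) ^ n"
      proof -
        have "k / real (card B) ^ n = 1 / real (card B) ^ u" using kpos by (simp add: s)
        moreover have "(real (card B) ^ u) ^ p = real (card B) ^ n"
          by (simp only: power_mult[symmetric] n_def mult.commute)
        ultimately show ?thesis by (simp only: power_one_over)
      qed
      then show ?thesis using kpos by (simp add: s)
    qed
    have "walk_const p p * k * (k / real (card B) ^ n) ^ p = walk_const p p / real (card B) ^ u"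
      using ks by (simp add: mult.assoc)
    also have "\<dots> \<le> \<epsilon> ^ (2 * p)"
      using u(1) \<epsilon> card_B_pos by (simp add: field_simps)
    finally obtain L where L: "L \<subseteq> frequencies n" "card L = k" "well_conditioned n L (1 - \<epsilon>) (1 + \<epsilon>)"
      using well_conditioned_subset_frequencies[OF p(1) k2 \<epsilon>] by blast
    have "L \<noteq> {}" using L kpos by auto
    then obtain a where a: "a \<in> L" by blast
    define L' where "L' = (\<lambda>l. l - a) ` L"
    define h where "h = K * \<rho> ^ (m + n)"
    have fin: "finite L'" using L finite_frequencies finite_subset unfolding L'_def by blast
    have lat: "L' \<subseteq> integer_lattice"
      using L a frequencies_lattice integer_lattice_closed(3) unfolding L'_def by blast
    have zero: "0 \<in> L'" using a by (auto simp: L'_def)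
    have card: "card L' = k"
      using L(2) unfolding L'_def by (subst card_image) (auto simp: inj_on_def)
    have wc: "well_conditioned n L' (1 - \<epsilon>) (1 + \<epsilon>)"
      unfolding L'_def by (rule well_conditioned_translate[OF L(3)])
    have hH: "h \<ge> H"
    proof -
      have "H \<le> 1 * \<rho> ^ u" using u(2) by simp
      also have "\<dots> \<le> K * \<rho> ^ (m + n)"
        using K rho n by (intro mult_mono power_increasing) auto
      finally show ?thesis by (simp add: h_def)
    qed
    have norm: "norm (Tp m l) < h" if "l \<in> L'" for l
    proof -
      obtain l' where l': "l' \<in> L" "l = l' - a" using \<open>l \<in> L'\<close> by (auto simp: L'_def)
      have "norm l \<le> norm l' + norm a" unfolding l' by (rule norm_triangle_ineq4)
      also have "\<dots> \<le> \<rho> ^ n * CARD('n) + \<rho> ^ n * CARD('n)"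
        using l' a L(1) by (intro add_mono norm_frequencies) auto
      also have "\<dots> < \<rho> ^ n * K" using rho_pos by (simp add: K_def algebra_simps)
      finally show ?thesis
        using rho_pos by (simp add: norm_Tp h_def power_add mult_ac)
    qed
    have "h powr (\<gamma> * sim_dim) = C * (real (card B) powr \<gamma>) ^ n"
      using K rho by (simp add: h_def powr_mult rho_power_powr_sim_dim C_def power_add)
    also have "\<dots> \<le> (real (card B) powr \<delta>) ^ u * (real (card B) powr \<gamma>) ^ n"
      using u(3) by (intro mult_right_mono) auto
    also have "\<dots> = real (card B) powr (\<delta> * u + \<gamma> * n)"
      using card_B_pos by (simp add: powr_add powr_powr flip: powr_realpow)
    also have "\<delta> * u + \<gamma> * n = real ((p - 1) * u)"
      using p(1) by (simp add: \<delta>_def n_def of_nat_diff algebra_simps)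
    also have "real (card B) powr \<dots> = k"
      using card_B_pos by (subst powr_realpow) (auto simp: k_def)
    finally show ?thesis
      using fin lat zero card wc hH norm by blast
  qed
qed

text \<open>At a point \<open>x + Ip m y\<close> of level \<open>m + n\<close>, the frequency
  \<open>Tp m l\<close> is trivial on \<open>x\<close> and acts on \<open>Ip m y\<close> as
  \<open>l\<close> does on \<open>y\<close>. For fixed \<open>y\<close> the sum is thus a
  combination of the characters in \<open>\<Lambda>\<close> at \<open>x\<close>, whose coefficients
  have the moduli of combinations of the characters in \<open>L\<close> at \<open>y\<close>; the two
  pairs of bounds apply one after the other.\<close>

lemma well_conditioned_compose:
  assumes \<Lambda>: "well_conditioned m \<Lambda> \<alpha> \<beta>" "\<alpha> \<ge> 0" "\<beta> \<ge> 0"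
    and L: "well_conditioned n L \<alpha>' \<beta>'" "L \<subseteq> integer_lattice"
    and inj: "inj_on (\<lambda>(a, l). a + Tp m l) (\<Lambda> \<times> L)"
  shows "well_conditioned (m + n) ((\<lambda>(a, l). a + Tp m l) ` (\<Lambda> \<times> L)) (\<alpha> * \<alpha>') (\<beta> * \<beta>')"
  unfolding well_conditioned_def
proof
  fix c :: "real ^ 'n \<Rightarrow> complex"
  define c' where "c' a l = c (a + Tp m l)" for a l
  define d where "d y a = exponential a (Ip m y) * (\<Sum>l\<in>L. c' a l * exponential l y)" for y a
  let ?I = "(\<lambda>(a, l). a + Tp m l) ` (\<Lambda> \<times> L)"
  have reidx: "sum f ?I = (\<Sum>a\<in>\<Lambda>. \<Sum>l\<in>L. f (a + Tp m l))" for f :: "real ^ 'n \<Rightarrow> 'z::comm_monoid_add"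
    unfolding sum.reindex[OF inj] sum.cartesian_product by (simp add: o_def case_prod_unfold)
  have sum_c: "(\<Sum>l\<in>?I. (cmod (c l))\<^sup>2) = (\<Sum>a\<in>\<Lambda>. \<Sum>l\<in>L. (cmod (c' a l))\<^sup>2)"
    by (simp only: reidx c'_def)
  have point: "(\<Sum>l\<in>?I. c l * exponential l (x + Ip m y)) = (\<Sum>a\<in>\<Lambda>. d y a * exponential a x)"
    if x: "x \<in> level_points m" for x y
  proof -
    have e: "exponential (a + Tp m l) (x + Ip m y)
        = exponential a (Ip m y) * exponential l y * exponential a x" if "l \<in> L" for a l
    proof -
      have "exponential (Tp m l) x = 1"
        using exponential_Tp_lattice Rp_level_points[OF x] L(2) that by blast
      then show ?thesis
        by (simp add: exponential_add_left exponential_add_right exponential_Tp)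
    qed
    have "(\<Sum>l\<in>?I. c l * exponential l (x + Ip m y))
        = (\<Sum>a\<in>\<Lambda>. \<Sum>l\<in>L. c' a l * exponential (a + Tp m l) (x + Ip m y))"
      by (simp only: reidx c'_def)
    also have "\<dots> = (\<Sum>a\<in>\<Lambda>. d y a * exponential a x)"
      unfolding d_def sum_distrib_left sum_distrib_right
      by (intro sum.cong refl) (simp only: e mult_ac)
    finally show ?thesis .
  qed
  let ?S = "\<lambda>x. (cmod (\<Sum>l\<in>?I. c l * exponential l x))\<^sup>2"
  have "avg (m + n) ?S = avg m (\<lambda>x. avg n (\<lambda>y. ?S (x + Ip m y)))"
    by (rule avg_add)
  also have "\<dots> = avg m (\<lambda>x. avg n (\<lambda>y. (cmod (\<Sum>a\<in>\<Lambda>. d y a * exponential a x))\<^sup>2))"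
    by (rule avg_cong) (simp only: point)
  also have "\<dots> = avg n (\<lambda>y. avg m (\<lambda>x. (cmod (\<Sum>a\<in>\<Lambda>. d y a * exponential a x))\<^sup>2))"
    unfolding avg_def sum_divide_distrib[symmetric] by (subst sum.swap) (simp add: mult.commute)
  finally have eq: "avg (m + n) ?S
      = avg n (\<lambda>y. avg m (\<lambda>x. (cmod (\<Sum>a\<in>\<Lambda>. d y a * exponential a x))\<^sup>2))" .
  have d: "avg n (\<lambda>y. k * (\<Sum>a\<in>\<Lambda>. (cmod (d y a))\<^sup>2))
     = k * (\<Sum>a\<in>\<Lambda>. avg n (\<lambda>y. (cmod (\<Sum>l\<in>L. c' a l * exponential l y))\<^sup>2))" for k
    unfolding avg_cmult avg_sum by (simp add: d_def norm_mult)
  note mL = L(1)[unfolded well_conditioned_def, rule_format]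
  note m\<Lambda> = \<Lambda>(1)[unfolded well_conditioned_def, rule_format]
  have "\<alpha> * (\<alpha>' * (\<Sum>a\<in>\<Lambda>. \<Sum>l\<in>L. (cmod (c' a l))\<^sup>2))
      \<le> \<alpha> * (\<Sum>a\<in>\<Lambda>. avg n (\<lambda>y. (cmod (\<Sum>l\<in>L. c' a l * exponential l y))\<^sup>2))"
    unfolding sum_distrib_left[of \<alpha>' _ \<Lambda>] using \<Lambda>(2) mL by (intro mult_left_mono sum_mono) auto
  also have "\<dots> \<le> avg (m + n) ?S"
    unfolding eq d[symmetric] using m\<Lambda> by (intro avg_mono) auto
  finally have lower: "\<alpha> * \<alpha>' * (\<Sum>l\<in>?I. (cmod (c l))\<^sup>2) \<le> avg (m + n) ?S"
    unfolding sum_c by (simp only: mult.assoc)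
  have "avg (m + n) ?S \<le> \<beta> * (\<Sum>a\<in>\<Lambda>. avg n (\<lambda>y. (cmod (\<Sum>l\<in>L. c' a l * exponential l y))\<^sup>2))"
    unfolding eq d[symmetric] using m\<Lambda> by (intro avg_mono) auto
  also have "\<dots> \<le> \<beta> * (\<beta>' * (\<Sum>a\<in>\<Lambda>. \<Sum>l\<in>L. (cmod (c' a l))\<^sup>2))"
    unfolding sum_distrib_left[of \<beta>' _ \<Lambda>] using \<Lambda>(3) mL by (intro mult_left_mono sum_mono) auto
  finally have upper: "avg (m + n) ?S \<le> \<beta> * \<beta>' * (\<Sum>l\<in>?I. (cmod (c l))\<^sup>2)"
    unfolding sum_c by (simp only: mult.assoc)
  show "\<alpha> * \<alpha>' * (\<Sum>l\<in>?I. (cmod (c l))\<^sup>2) \<le> avg (m + n) ?S \<and>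
      avg (m + n) ?S \<le> \<beta> * \<beta>' * (\<Sum>l\<in>?I. (cmod (c l))\<^sup>2)"
    using lower upper by blast
qed

text \<open>Frequencies congruent modulo the image of the lattice under \<open>Tp m\<close> give the
  same function on \<open>level_points m\<close>, and the difference of the two characters would
  violate the lower bound. This yields the injectivity that composition requires.\<close>

lemma well_conditioned_distinct:
  assumes "well_conditioned m \<Lambda> \<alpha> \<beta>" "\<alpha> > 0" "finite \<Lambda>"
    and "a \<in> \<Lambda>" "a' \<in> \<Lambda>" "w \<in> integer_lattice" "a = a' + Tp m w"
  shows "a = a'"
proof (rule ccontr)
  assume ne: "a \<noteq> a'"
  define c :: "real ^ 'n \<Rightarrow> complex" where "c l = (if l = a then 1 else if l = a' then - 1 else 0)" for l
  have c: "(\<Sum>l\<in>\<Lambda>. f l (c l)) = f a 1 + f a' (- 1)" if "\<And>l. f l 0 = 0" for f :: "real ^ 'n \<Rightarrow> complex \<Rightarrow> 'z::ab_group_add"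
  proof -
    have "(\<Sum>l\<in>\<Lambda>. f l (c l)) = (\<Sum>l\<in>{a, a'}. f l (c l))"
      using assms that by (intro sum.mono_neutral_right) (auto simp: c_def)
    then show ?thesis using ne by (simp add: c_def)
  qed
  have "(\<Sum>l\<in>\<Lambda>. c l * exponential l x) = 0" if "x \<in> level_points m" for x
  proof -
    have "exponential a x = exponential a' x"
      using exponential_Tp_lattice[OF assms(6) Rp_level_points[OF that]]
      by (simp add: assms(7) exponential_add_left)
    with c[of "\<lambda>l t. t * exponential l x"] show ?thesis by simp
  qed
  then have "avg m (\<lambda>x. (cmod (\<Sum>l\<in>\<Lambda>. c l * exponential l x))\<^sup>2) = 0"
    by (simp add: avg_def)
  moreover have "(\<Sum>l\<in>\<Lambda>. (cmod (c l))\<^sup>2) = 2"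
    using c[of "\<lambda>l t. (cmod t)\<^sup>2"] by simp
  ultimately show False
    using assms(1)[unfolded well_conditioned_def, rule_format, of c] \<open>\<alpha> > 0\<close> by simp
qed

end

section \<open>Riesz bounds and Beurling dimension for the self-similar measure\<close>

locale self_similar = similarity_digits R Q \<rho> B
  for R Q :: "real ^ 'n ^ 'n" and \<rho> :: real and B :: "(real ^ 'n) set" +
  fixes \<mu> :: "(real ^ 'n) measure"
  assumes self_sim: "is_self_similar_measure R B \<mu>"
begin

sublocale prob_space \<mu>
  using self_sim by (simp add: is_self_similar_measure_def)

lemma sets_mu [measurable_cong, simp]: "sets \<mu> = sets borel"
  using self_sim by (simp add: is_self_similar_measure_def)

lemma space_mu [simp]: "space \<mu> = UNIV"
  using sets_eq_imp_space_eq[OF sets_mu] by simp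

lemma continuous_ifs_map: "continuous_on UNIV (ifs_map R b)"
  unfolding ifs_map_def[abs_def]
  by (intro linear_continuous_on_compose[OF _ matrix_vector_mul_linear] continuous_intros)

lemma ifs_map_measurable [measurable]: "ifs_map R b \<in> borel_measurable borel"
  by (rule borel_measurable_continuous_onI[OF continuous_ifs_map])

lemma Ip_measurable [measurable]: "Ip n \<in> borel_measurable borel"
  by (intro borel_measurable_continuous_onI linear_continuous_on linear_mat_pow_vec[THEN linear_conv_bounded_linear[THEN iffD1]])

section \<open>Self-similarity as an integration formula\<close>

lemma emeasure_self_similar:
  assumes A: "A \<in> sets borel"
  shows "of_nat (card B) * emeasure \<mu> A = (\<Sum>b\<in>B. emeasure \<mu> (ifs_map R b -` A))"
proof -
  have "measure \<mu> A = (\<Sum>b\<in>B. measure \<mu> (ifs_map R b -` A)) / card B"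
    using self_sim A by (simp add: is_self_similar_measure_def)
  then have "card B * measure \<mu> A = (\<Sum>b\<in>B. measure \<mu> (ifs_map R b -` A))"
    using card_B_pos by (simp add: field_simps)
  then show ?thesis
    by (simp add: emeasure_eq_measure sum_ennreal ennreal_mult[symmetric] flip: ennreal_of_nat_eq_real_of_nat)
      (simp add: ennreal_of_nat_eq_real_of_nat ennreal_mult[symmetric])
qed

lemma nn_integral_self_similar:
  fixes g :: "real ^ 'n \<Rightarrow> ennreal"
  assumes "g \<in> borel_measurable borel"
  shows "of_nat (card B) * (\<integral>\<^sup>+y. g y \<partial>\<mu>) = (\<Sum>b\<in>B. \<integral>\<^sup>+y. g (ifs_map R b y) \<partial>\<mu>)"
  using assms
proof (induction rule: borel_measurable_induct)
  case (cong f g)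
  then have "f = g" by auto
  with cong show ?case by simp
next
  case (set A)
  have "(\<integral>\<^sup>+y. indicator A (ifs_map R b y) \<partial>\<mu>) = emeasure \<mu> (ifs_map R b -` A)" for b
  proof -
    have "ifs_map R b -` A \<in> sets \<mu>"
      using measurable_sets[OF ifs_map_measurable set, of b] by simp
    moreover have "(indicator A (ifs_map R b y) :: ennreal) = indicator (ifs_map R b -` A) y" for y
      by (simp add: indicator_def)
    ultimately show ?thesis by simp
  qed
  then show ?case using set emeasure_self_similar[OF set] by simp
next
  case (mult u c)
  note [measurable] = \<open>u \<in> borel_measurable borel\<close>
  show ?case
    using mult.IH by (simp add: nn_integral_cmult mult.left_commute sum_distrib_left)
next
  case (add u v)
  note [measurable] = \<open>u \<in> borel_measurable borel\<close> \<open>v \<in> borel_measurable borel\<close>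
  show ?case
    using add.IH by (simp add: nn_integral_add distrib_left sum.distrib)
next
  case (seq U)
  note [measurable] = \<open>\<And>i. U i \<in> borel_measurable borel\<close>
  have inc: "incseq (\<lambda>i y. U i (ifs_map R b y))" for b
    using \<open>incseq U\<close> by (auto simp: incseq_def le_fun_def)
  have "of_nat (card B) * (\<integral>\<^sup>+y. (SUP i. U i) y \<partial>\<mu>) = of_nat (card B) * (SUP i. \<integral>\<^sup>+y. U i y \<partial>\<mu>)"
    using \<open>incseq U\<close> by (simp add: nn_integral_monotone_convergence_SUP image_comp)
  also have "\<dots> = (SUP i. of_nat (card B) * (\<integral>\<^sup>+y. U i y \<partial>\<mu>))"
    by (rule SUP_mult_left_ennreal)
  also have "\<dots> = (SUP i. \<Sum>b\<in>B. \<integral>\<^sup>+y. U i (ifs_map R b y) \<partial>\<mu>)"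
    by (simp only: seq.IH)
  also have "\<dots> = (\<Sum>b\<in>B. SUP i. \<integral>\<^sup>+y. U i (ifs_map R b y) \<partial>\<mu>)"
    using inc by (intro ennreal_SUP_sum) (auto simp: incseq_def le_fun_def intro!: nn_integral_mono)
  also have "\<dots> = (\<Sum>b\<in>B. \<integral>\<^sup>+y. (SUP i. U i (ifs_map R b y)) \<partial>\<mu>)"
    using inc by (intro sum.cong refl nn_integral_monotone_convergence_SUP[symmetric]) measurable
  finally show ?case by (simp add: image_comp)
qed

lemma integrable_bounded_nonneg:
  fixes g :: "real ^ 'n \<Rightarrow> real"
  assumes "g \<in> borel_measurable borel" "\<And>x. 0 \<le> g x" "\<And>x. g x \<le> C"
  shows "integrable \<mu> g"
  using assms by (intro integrable_const_bound[where B = C]) (auto simp: measurable_cong_sets[OF sets_mu refl])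

lemma integral_self_similar:
  fixes g :: "real ^ 'n \<Rightarrow> real"
  assumes g [measurable]: "g \<in> borel_measurable borel" and bd: "\<And>x. 0 \<le> g x" "\<And>x. g x \<le> C"
  shows "(LINT y|\<mu>. g y) = (\<Sum>b\<in>B. LINT y|\<mu>. g (ifs_map R b y)) / card B"
proof -
  have i: "(\<integral>\<^sup>+y. ennreal (g y) \<partial>\<mu>) = ennreal (LINT y|\<mu>. g y)"
    using integrable_bounded_nonneg[OF g bd] bd by (intro nn_integral_eq_integral) auto
  have ib: "(\<integral>\<^sup>+y. ennreal (g (ifs_map R b y)) \<partial>\<mu>) = ennreal (LINT y|\<mu>. g (ifs_map R b y))" for b
    using integrable_bounded_nonneg[of "\<lambda>y. g (ifs_map R b y)" C] bd
    by (intro nn_integral_eq_integral) auto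
  have "ennreal (card B * (LINT y|\<mu>. g y)) = of_nat (card B) * (\<integral>\<^sup>+y. ennreal (g y) \<partial>\<mu>)"
    using bd by (simp add: i ennreal_mult ennreal_of_nat_eq_real_of_nat integral_nonneg_AE)
  also have "\<dots> = (\<Sum>b\<in>B. \<integral>\<^sup>+y. ennreal (g (ifs_map R b y)) \<partial>\<mu>)"
    by (rule nn_integral_self_similar) measurable
  also have "\<dots> = ennreal (\<Sum>b\<in>B. LINT y|\<mu>. g (ifs_map R b y))"
    unfolding ib using bd by (intro sum_ennreal) (simp add: integral_nonneg_AE)
  finally have "card B * (LINT y|\<mu>. g y) = (\<Sum>b\<in>B. LINT y|\<mu>. g (ifs_map R b y))"
    using bd by (subst (asm) ennreal_inj) (auto intro!: sum_nonneg mult_nonneg_nonneg integral_nonneg_AE)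
  then show ?thesis using card_B_pos by (simp add: field_simps)
qed

text \<open>Iterated self-similarity: the measure is the convolution of the uniform measure on
  \<open>level_points m\<close> with its own image under \<open>Ip m\<close>.\<close>

lemma integral_eq_avg:
  fixes g :: "real ^ 'n \<Rightarrow> real"
  assumes g: "g \<in> borel_measurable borel" and bd: "\<And>x. 0 \<le> g x" "\<And>x. g x \<le> C"
  shows "(LINT y|\<mu>. g y) = avg m (\<lambda>x. LINT y|\<mu>. g (x + Ip m y))"
  using assms
proof (induction m arbitrary: g)
  case 0
  show ?case by (simp add: avg_def)
next
  case (Suc m)
  note [measurable] = Suc.prems(1)
  have "(LINT y|\<mu>. g y) = (\<Sum>b\<in>B. LINT y|\<mu>. g (ifs_map R b y)) / card B"
    by (rule integral_self_similar[OF Suc.prems])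
  also have "\<dots> = (\<Sum>b\<in>B. avg m (\<lambda>x. LINT y|\<mu>. g (ifs_map R b (x + Ip m y)))) / card B"
    by (intro arg_cong2[of _ _ _ _ "(/)"] sum.cong refl Suc.IH) (use Suc.prems in measurable)
  finally show ?case by (simp only: avg_Suc ifs_map_add_Ip)
qed

lemma measure_ge_level:
  assumes A: "A \<in> sets borel" and x: "x \<in> level_points m"
  shows "measure \<mu> A \<ge> measure \<mu> ((\<lambda>y. x + Ip m y) -` A) / real (card B) ^ m"
proof -
  have vim: "(\<lambda>y. z + Ip m y) -` A \<in> sets borel" for z
    using measurable_sets[of "\<lambda>y. z + Ip m y" borel borel A] A by simp
  have "measure \<mu> A = (LINT y|\<mu>. indicator A y)" using A by simp
  also have "\<dots> = avg m (\<lambda>z. LINT y|\<mu>. indicator A (z + Ip m y))"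
    using A by (intro integral_eq_avg[where C = 1]) (auto simp: indicator_def)
  also have "\<dots> = avg m (\<lambda>z. measure \<mu> ((\<lambda>y. z + Ip m y) -` A))"
  proof (rule avg_cong)
    fix z
    have "(indicator A (z + Ip m y) :: real) = indicator ((\<lambda>y. z + Ip m y) -` A) y" for y
      by (simp add: indicator_def)
    then show "(LINT y|\<mu>. indicator A (z + Ip m y)) = measure \<mu> ((\<lambda>y. z + Ip m y) -` A)"
      using vim by simp
  qed
  also have "\<dots> \<ge> measure \<mu> ((\<lambda>y. x + Ip m y) -` A) / real (card B) ^ m"
    unfolding avg_def using x by (intro divide_right_mono member_le_sum) auto
  finally show ?thesis .
qed

section \<open>Riesz bounds from a finite level\<close>

lemma continuous_exponential [continuous_intros]:
  "continuous_on UNIV (exponential (l :: real ^ 'n))"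
  unfolding exponential_def[abs_def] by (intro continuous_intros)

text \<open>In \<open>x + Ip m y\<close> the tail \<open>Ip m y\<close> only multiplies each
  coefficient by a number of modulus 1. The bounds at level \<open>m\<close> hold for every fixed
  \<open>y\<close> and survive integration over \<open>y\<close> with the same constants.\<close>

lemma well_conditioned_imp_Riesz_bounds:
  assumes wc: "well_conditioned m \<Lambda> \<alpha> \<beta>"
  shows "\<alpha> * (\<Sum>l\<in>\<Lambda>. (cmod (c l))\<^sup>2) \<le> (LINT y|\<mu>. (cmod (\<Sum>l\<in>\<Lambda>. c l * exponential l y))\<^sup>2)"
    and "(LINT y|\<mu>. (cmod (\<Sum>l\<in>\<Lambda>. c l * exponential l y))\<^sup>2) \<le> \<beta> * (\<Sum>l\<in>\<Lambda>. (cmod (c l))\<^sup>2)"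
proof -
  let ?S = "\<lambda>y. (cmod (\<Sum>l\<in>\<Lambda>. c l * exponential l y))\<^sup>2"
  let ?c = "\<Sum>l\<in>\<Lambda>. (cmod (c l))\<^sup>2"
  have meas: "?S \<in> borel_measurable borel"
    by (intro borel_measurable_continuous_onI continuous_intros)
  have bd: "?S y \<le> (\<Sum>l\<in>\<Lambda>. cmod (c l))\<^sup>2" for y
    by (intro power_mono order_trans[OF norm_sum]) (auto simp: norm_mult)
  have int: "integrable \<mu> (\<lambda>y. ?S (x + Ip m y))" for x
  proof (rule integrable_bounded_nonneg)
    show "(\<lambda>y. ?S (x + Ip m y)) \<in> borel_measurable borel"
      by (rule measurable_compose[OF _ meas]) measurable
  qed (use bd in auto)
  have "(LINT y|\<mu>. ?S y) = avg m (\<lambda>x. LINT y|\<mu>. ?S (x + Ip m y))"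
    by (rule integral_eq_avg[OF meas _ bd]) simp
  also have "\<dots> = (LINT y|\<mu>. avg m (\<lambda>x. ?S (x + Ip m y)))"
    unfolding avg_def using int by (simp add: Bochner_Integration.integral_sum)
  finally have eq: "(LINT y|\<mu>. ?S y) = (LINT y|\<mu>. avg m (\<lambda>x. ?S (x + Ip m y)))" .
  have int': "integrable \<mu> (\<lambda>y. avg m (\<lambda>x. ?S (x + Ip m y)))"
    unfolding avg_def using int by (intro integrable_divide Bochner_Integration.integrable_sum)
  have point: "\<alpha> * ?c \<le> avg m (\<lambda>x. ?S (x + Ip m y)) \<and> avg m (\<lambda>x. ?S (x + Ip m y)) \<le> \<beta> * ?c" for y
  proof -
    have "?S (x + Ip m y) = (cmod (\<Sum>l\<in>\<Lambda>. (c l * exponential l (Ip m y)) * exponential l x))\<^sup>2" for x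
      by (simp add: exponential_add_right mult_ac)
    then show ?thesis
      using wc[unfolded well_conditioned_def, rule_format, of "\<lambda>l. c l * exponential l (Ip m y)"]
      by (simp add: norm_mult)
  qed
  have "prob UNIV = 1" using prob_space by (simp only: space_mu)
  then have const: "(LINT y|\<mu>. k) = k" for k :: real
    by simp
  show "\<alpha> * ?c \<le> (LINT y|\<mu>. ?S y)"
    unfolding eq using point by (subst const[symmetric], intro integral_mono int') auto
  show "(LINT y|\<mu>. ?S y) \<le> \<beta> * ?c"
    unfolding eq using point by (subst (2) const[symmetric], intro integral_mono int') auto
qed

text \<open>The strict inequalities leave room for further factors \<open>1 - \<epsilon>\<close> and
  \<open>1 + \<epsilon>\<close> at every stage, so 1/2 and 2 remain bounds for the union. Since 0
  belongs to the set, the scaled new block is part of the extension.\<close>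

definition good_state :: "nat \<times> (real ^ 'n) set \<Rightarrow> bool" where
  "good_state s \<longleftrightarrow> finite (snd s) \<and> snd s \<subseteq> integer_lattice \<and> 0 \<in> snd s \<and>
     (\<exists>\<alpha> \<beta>. 1/2 < \<alpha> \<and> 0 < \<beta> \<and> \<beta> < 2 \<and> well_conditioned (fst s) (snd s) \<alpha> \<beta>)"

lemma extend_good_state:
  assumes s: "good_state s" and \<gamma>: "0 \<le> \<gamma>" "\<gamma> < 1"
  shows "\<exists>s'. good_state s' \<and> snd s \<subseteq> snd s' \<and>
    (\<exists>h\<ge>H. h powr (\<gamma> * sim_dim) \<le> card (snd s' \<inter> ball 0 h))"
proof -
  obtain m \<Lambda> where s_eq: "s = (m, \<Lambda>)" by fastforce
  with s obtain \<alpha> \<beta> where \<Lambda>: "finite \<Lambda>" "\<Lambda> \<subseteq> integer_lattice" "0 \<in> \<Lambda>"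
    and ab: "1/2 < \<alpha>" "0 < \<beta>" "\<beta> < 2" and wc: "well_conditioned m \<Lambda> \<alpha> \<beta>"
    by (auto simp: good_state_def)
  \<comment> \<open>The quotients spend half of the room that is left:
    \<open>\<alpha> * \<epsilon> \<le> (\<alpha> - 1/2) / 2\<close> and
    \<open>\<beta> * \<epsilon> \<le> (2 - \<beta>) / 2\<close>.\<close>
  define \<epsilon> where "\<epsilon> = min (1/2) (min ((\<alpha> - 1/2) / (2 * \<alpha>)) ((2 - \<beta>) / (2 * \<beta>)))"
  have \<epsilon>: "0 < \<epsilon>" "\<epsilon> \<le> 1/2" "\<epsilon> \<le> (\<alpha> - 1/2) / (2 * \<alpha>)" "\<epsilon> \<le> (2 - \<beta>) / (2 * \<beta>)"
    using ab by (auto simp: \<epsilon>_def)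
  have \<epsilon>1: "\<epsilon> \<le> 1" using \<epsilon> by linarith
  have \<alpha>': "1/2 < \<alpha> * (1 - \<epsilon>)" using \<epsilon>(3) ab by (simp add: field_simps)
  have \<beta>': "\<beta> * (1 + \<epsilon>) < 2" using \<epsilon>(4) ab by (simp add: field_simps)
  obtain n L h where L: "finite L" "L \<subseteq> integer_lattice" "0 \<in> L"
    and wcL: "well_conditioned n L (1 - \<epsilon>) (1 + \<epsilon>)"
    and h: "h \<ge> H" "\<forall>l\<in>L. norm (Tp m l) < h" "h powr (\<gamma> * sim_dim) \<le> card L"
    using exists_block[OF \<epsilon>(1) \<epsilon>1 \<gamma>, of H m] by blast
  have inj: "inj_on (\<lambda>(a, l). a + Tp m l) (\<Lambda> \<times> L)"
  proof (rule inj_onI, clarify)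
    fix a l a' l' assume A: "a \<in> \<Lambda>" "l \<in> L" "a' \<in> \<Lambda>" "l' \<in> L" and eq: "a + Tp m l = a' + Tp m l'"
    have "a = a' + Tp m (l' - l)" using eq by (simp add: algebra_simps)
    moreover have "l' - l \<in> integer_lattice" using A L integer_lattice_closed(3) by blast
    ultimately have "a = a'" using well_conditioned_distinct[OF wc _ \<Lambda>(1)] A ab by fastforce
    with eq show "a = a' \<and> l = l'" by (simp add: Tp_inj)
  qed
  define \<Lambda>' where "\<Lambda>' = (\<lambda>(a, l). a + Tp m l) ` (\<Lambda> \<times> L)"
  have wc': "well_conditioned (m + n) \<Lambda>' (\<alpha> * (1 - \<epsilon>)) (\<beta> * (1 + \<epsilon>))"
    unfolding \<Lambda>'_def using ab by (intro well_conditioned_compose wc wcL L inj) auto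
  have sub: "\<Lambda> \<subseteq> \<Lambda>'"
  proof
    fix a assume "a \<in> \<Lambda>"
    then show "a \<in> \<Lambda>'" unfolding \<Lambda>'_def using L(3) by (intro image_eqI[of _ _ "(a, 0)"]) auto
  qed
  have lat: "\<Lambda>' \<subseteq> integer_lattice"
    using \<Lambda>(2) L(2) Tp_lattice by (auto simp: \<Lambda>'_def intro!: integer_lattice_closed(2))
  have fin: "finite \<Lambda>'" using \<Lambda>(1) L(1) by (simp add: \<Lambda>'_def)
  have "0 < \<beta> * (1 + \<epsilon>)" using ab \<epsilon> by simp
  then have "good_state (m + n, \<Lambda>')"
    unfolding good_state_def fst_conv snd_conv using fin lat sub \<Lambda>(3) wc' \<alpha>' \<beta>' by blast
  moreover have "Tp m ` L \<subseteq> \<Lambda>' \<inter> ball 0 h"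
  proof clarify
    fix l assume l: "l \<in> L"
    then have "Tp m l \<in> \<Lambda>'"
      unfolding \<Lambda>'_def using \<Lambda>(3) by (intro image_eqI[of _ _ "(0, l)"]) auto
    then show "Tp m l \<in> \<Lambda>' \<inter> ball 0 h" using h(2) l by simp
  qed
  then have "card (Tp m ` L) \<le> card (\<Lambda>' \<inter> ball 0 h)"
    using fin by (intro card_mono) auto
  then have "card L \<le> card (\<Lambda>' \<inter> ball 0 h)"
    by (simp add: card_image inj_on_def Tp_inj)
  then have "h powr (\<gamma> * sim_dim) \<le> card (\<Lambda>' \<inter> ball 0 h)" using h(3) by linarith
  ultimately show ?thesis
    using sub h(1) by (intro exI[of _ "(m + n, \<Lambda>')"]) (auto simp: s_eq)
qed

lemma good_state_zero: "good_state (0, {0})"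
  unfolding good_state_def using well_conditioned_zero[of 0]
  by (auto simp: integer_lattice_closed intro!: exI[of _ "1::real"])

text \<open>The exponents \<open>1 - 1 / (real J + 2)\<close> stay below 1, as the extension step
  demands, and tend to 1. Any finite part of the union lies in a single stage, so the bounds of the
  stages pass to the union.\<close>

lemma exists_dense_riesz_frequencies:
  "\<exists>\<Lambda>. countable \<Lambda> \<and> riesz_bounds \<mu> \<Lambda> exponential (1/2) 2 \<and>
    (\<forall>J::nat. \<exists>F h. finite F \<and> F \<subseteq> \<Lambda> \<and> h \<ge> real J \<and>
      h powr ((1 - 1 / (real J + 2)) * sim_dim) \<le> card (F \<inter> ball 0 h))"
proof -
  let ?Q = "\<lambda>J s s'. snd s \<subseteq> snd s' \<and>
    (\<exists>h\<ge>real J. h powr ((1 - 1 / (real J + 2)) * sim_dim) \<le> card (snd s' \<inter> ball 0 h))"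
  have "\<exists>s. \<forall>J. good_state (s J) \<and> ?Q J (s J) (s (Suc J))"
  proof (rule dependent_nat_choice)
    show "\<exists>s. good_state s" using good_state_zero by blast
    show "\<exists>s'. good_state s' \<and> ?Q J s s'" if "good_state s" for s J
      by (rule extend_good_state[OF that]) (auto simp: field_simps)
  qed
  then obtain s where s: "\<And>J. good_state (s J)" "\<And>J. ?Q J (s J) (s (Suc J))" by blast
  define \<Lambda> where "\<Lambda> = (\<Union>J. snd (s J))"
  have fin: "finite (snd (s J))" for J using s(1) by (simp add: good_state_def)
  have inc: "snd (s I) \<subseteq> snd (s J)" if "I \<le> J" for I J
    using lift_Suc_mono_le[of "\<lambda>J. snd (s J)", OF _ that] s(2) by blast
  have "countable \<Lambda>" unfolding \<Lambda>_def by (intro countable_UN[OF countableI_type] countable_finite[OF fin])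
  moreover have "riesz_bounds \<mu> \<Lambda> exponential (1/2) 2"
    unfolding riesz_bounds_def
  proof (intro allI impI)
    fix F and a :: "real ^ 'n \<Rightarrow> complex"
    assume F: "finite F" "F \<subseteq> \<Lambda>"
    have "\<exists>J. F \<subseteq> snd (s J)"
      using F
    proof (induction F)
      case (insert x F)
      then obtain I J where "F \<subseteq> snd (s I)" "x \<in> snd (s J)" by (auto simp: \<Lambda>_def)
      then have "insert x F \<subseteq> snd (s (max I J))" using inc[of I "max I J"] inc[of J "max I J"] by auto
      then show ?case by blast
    qed simp
    then obtain J where J: "F \<subseteq> snd (s J)" by blast
    obtain \<alpha> \<beta> where ab: "1/2 < \<alpha>" "\<beta> < 2" and wc: "well_conditioned (fst (s J)) (snd (s J)) \<alpha> \<beta>"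
      using s(1)[of J] by (auto simp: good_state_def)
    \<comment> \<open>Extension by 0 turns a sum over \<open>F\<close> into one over the whole
      stage.\<close>
    define c where "c l = (if l \<in> F then a l else 0)" for l
    have c1: "(\<Sum>l\<in>snd (s J). (cmod (c l))\<^sup>2) = (\<Sum>l\<in>F. (cmod (a l))\<^sup>2)"
      using J fin by (intro sum.mono_neutral_cong_right) (auto simp: c_def)
    have c2: "(\<Sum>l\<in>snd (s J). c l * exponential l y) = (\<Sum>l\<in>F. a l * exponential l y)" for y
      using J fin by (intro sum.mono_neutral_cong_right) (auto simp: c_def)
    note bounds = well_conditioned_imp_Riesz_bounds[OF wc, of c, unfolded c1 c2]
    have "0 \<le> (\<Sum>l\<in>F. (cmod (a l))\<^sup>2)" by (simp add: sum_nonneg)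
    then have "1/2 * (\<Sum>l\<in>F. (cmod (a l))\<^sup>2) \<le> \<alpha> * (\<Sum>l\<in>F. (cmod (a l))\<^sup>2)"
      "\<beta> * (\<Sum>l\<in>F. (cmod (a l))\<^sup>2) \<le> 2 * (\<Sum>l\<in>F. (cmod (a l))\<^sup>2)"
      using ab by (intro mult_right_mono; simp)+
    with bounds show "1/2 * (\<Sum>k\<in>F. (cmod (a k))\<^sup>2) \<le> (LINT x|\<mu>. (cmod (\<Sum>k\<in>F. a k * exponential k x))\<^sup>2) \<and>
      (LINT x|\<mu>. (cmod (\<Sum>k\<in>F. a k * exponential k x))\<^sup>2) \<le> 2 * (\<Sum>k\<in>F. (cmod (a k))\<^sup>2)"
      by linarith
  qed
  moreover have "\<exists>F h. finite F \<and> F \<subseteq> \<Lambda> \<and> h \<ge> real J \<and>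
      h powr ((1 - 1 / (real J + 2)) * sim_dim) \<le> card (F \<inter> ball 0 h)" for J :: nat
  proof -
    obtain h where "h \<ge> real J"
      "h powr ((1 - 1 / (real J + 2)) * sim_dim) \<le> card (snd (s (Suc J)) \<inter> ball 0 h)"
      using s(2)[of J] by blast
    then show ?thesis
      using fin by (intro exI[of _ "snd (s (Suc J))"] exI[of _ h]) (auto simp: \<Lambda>_def)
  qed
  ultimately show ?thesis by blast
qed

lemma riesz_sequence_exponential:
  assumes "riesz_bounds \<mu> \<Lambda> exponential C D" "C > 0" "D > 0"
  shows "riesz_sequence_L2 \<mu> \<Lambda> exponential"
proof -
  have in_L2: "in_L2 \<mu> (exponential l)" for l
    unfolding in_L2_def
    by (simp add: measurable_cong_sets[OF sets_mu refl] borel_measurable_continuous_onI[OF continuous_exponential])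
  have norm: "(L2_norm \<mu> f)\<^sup>2 = (LINT x|\<mu>. (cmod (f x))\<^sup>2)" for f
    by (simp add: L2_norm_def integral_nonneg_AE)
  show ?thesis
    unfolding riesz_sequence_L2_def norm
    by (intro conjI ballI in_L2 exI[of _ C] exI[of _ D] assms(2,3) allI impI;
        use assms(1)[unfolded riesz_bounds_def, rule_format] in simp)
qed

section \<open>The upper bound for the density of a Bessel sequence\<close>

lemma exists_cball_half: "\<exists>r\<ge>1. measure \<mu> (cball 0 r) \<ge> 1/2"
proof -
  have "(\<lambda>n. measure \<mu> (cball 0 (real n))) \<longlonglongrightarrow> measure \<mu> (\<Union>n. cball 0 (real n))"
    by (intro finite_Lim_measure_incseq) (auto simp: incseq_def intro!: subset_cball)
  moreover have "(\<Union>n. cball 0 (real n)) = (UNIV :: (real ^ 'n) set)"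
    using real_arch_simple by (auto simp: dist_norm)
  moreover have "measure \<mu> UNIV = 1" using prob_space by (simp only: space_mu)
  ultimately have "(\<lambda>n. measure \<mu> (cball 0 (real n))) \<longlonglongrightarrow> 1" by simp
  then have "eventually (\<lambda>n. 1/2 < measure \<mu> (cball 0 (real n))) sequentially"
    by (rule order_tendstoD) simp
  moreover have "eventually (\<lambda>n. n \<ge> 1) sequentially" by (rule eventually_ge_at_top)
  ultimately have "eventually (\<lambda>n. 1/2 < measure \<mu> (cball 0 (real n)) \<and> n \<ge> 1) sequentially"
    by eventually_elim simp
  then obtain n where "1/2 < measure \<mu> (cball 0 (real n))" "n \<ge> 1"
    by (auto simp: eventually_sequentially)
  then show ?thesis by (intro exI[of _ "real n"]) auto
qed

text \<open>Around \<open>z\<close> lies a copy of the measure, contracted by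
  \<open>\<rho> ^ n\<close> and of total mass \<open>1 / card B ^ n\<close>; the ball catches at
  least half of it.\<close>

lemma measure_small_cball:
  assumes r: "measure \<mu> (cball 0 r) \<ge> 1/2" and z: "z \<in> level_points n"
  shows "measure \<mu> (cball z (r / \<rho> ^ n)) \<ge> 1 / (2 * real (card B) ^ n)"
proof -
  have "cball 0 r \<subseteq> (\<lambda>y. z + Ip n y) -` cball z (r / \<rho> ^ n)"
    using rho_pos by (auto simp: dist_norm norm_Ip intro!: divide_right_mono)
  moreover have "(\<lambda>y. z + Ip n y) -` cball z (r / \<rho> ^ n) \<in> sets \<mu>"
    using measurable_sets[of "\<lambda>y. z + Ip n y" borel borel "cball z (r / \<rho> ^ n)"] by simp
  ultimately have "measure \<mu> (cball 0 r) \<le> measure \<mu> ((\<lambda>y. z + Ip n y) -` cball z (r / \<rho> ^ n))"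
    by (intro finite_measure_mono)
  then have "1/2 / real (card B) ^ n \<le> measure \<mu> ((\<lambda>y. z + Ip n y) -` cball z (r / \<rho> ^ n)) / real (card B) ^ n"
    using r by (intro divide_right_mono) auto
  also have "\<dots> \<le> measure \<mu> (cball z (r / \<rho> ^ n))"
    by (rule measure_ge_level[OF _ z]) simp
  finally show ?thesis by simp
qed

text \<open>All frequencies in a ball of radius \<open>h\<close> are nearly in phase on a ball of radius \<open>1/(6h)\<close>, so
  the Bessel bound limits their number by the mass of the latter.\<close>

lemma card_le_of_Bessel:
  assumes riesz: "riesz_bounds \<mu> \<Lambda> exponential C D" and F: "finite F" "F \<subseteq> \<Lambda> \<inter> ball x h"
    and h: "h > 0" and r: "r \<le> 1 / (6 * h)" and "D \<ge> 0"
  shows "card F * measure \<mu> (cball z r) \<le> 4 * D"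
proof (cases "F = {}")
  case True
  then show ?thesis using \<open>D \<ge> 0\<close> by simp
next
  case False
  \<comment> \<open>The coefficients cancel the phases at \<open>z\<close>, so that all terms are 1
    there.\<close>
  define f where "f y = (\<Sum>l\<in>F. exponential (- l) z * exponential l y)" for y
  have meas: "f \<in> borel_measurable borel"
    unfolding f_def[abs_def] by (intro borel_measurable_continuous_onI continuous_intros)
  have "cmod (f y) \<ge> card F / 2" if y: "y \<in> cball z r" for y
  proof -
    \<comment> \<open>A factor of modulus 1 moves the centre of the frequencies to 0. The phases are
      then at most \<open>2 * pi / 6 = pi / 3\<close>, whose cosine is 1/2.\<close>
    have "f y * exponential (- x) (y - z) = (\<Sum>l\<in>F. exponential (l - x) (y - z))"
      unfolding f_def sum_distrib_right
      by (intro sum.cong refl)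
        (simp add: exponential_def inner_diff_left inner_diff_right algebra_simps flip: exp_add)
    then have "cmod (f y) = cmod (\<Sum>l\<in>F. exponential (l - x) (y - z))"
      by (metis norm_exponential norm_mult mult_1_right)
    also have "\<dots> \<ge> Re (\<Sum>l\<in>F. exponential (l - x) (y - z))" by (rule complex_Re_le_cmod)
    also have "Re (\<Sum>l\<in>F. exponential (l - x) (y - z)) = (\<Sum>l\<in>F. cos (2 * pi * ((l - x) \<bullet> (y - z))))"
      by (simp add: exponential_def Re_exp)
    also have "\<dots> \<ge> (\<Sum>l\<in>F. 1/2)"
    proof (rule sum_mono)
      fix l assume "l \<in> F"
      then have "norm (l - x) \<le> h" using F by (auto simp: dist_norm norm_minus_commute)
      moreover have "norm (y - z) \<le> 1 / (6 * h)"
        using y r by (auto simp: dist_norm norm_minus_commute)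
      ultimately have "norm (l - x) * norm (y - z) \<le> h * (1 / (6 * h))"
        using h by (intro mult_mono) auto
      then have "\<bar>(l - x) \<bullet> (y - z)\<bar> \<le> 1/6"
        using Cauchy_Schwarz_ineq2[of "l - x" "y - z"] h by simp
      then have "\<bar>2 * pi * ((l - x) \<bullet> (y - z))\<bar> \<le> pi / 3"
        by (simp add: abs_mult)
      then have "cos (pi / 3) \<le> cos \<bar>2 * pi * ((l - x) \<bullet> (y - z))\<bar>"
        by (intro cos_monotone_0_pi_le) auto
      then show "1/2 \<le> cos (2 * pi * ((l - x) \<bullet> (y - z)))" by (simp add: cos_60)
    qed
    finally show ?thesis by simp
  qed
  then have point: "(card F / 2)\<^sup>2 * indicator (cball z r) y \<le> (cmod (f y))\<^sup>2" for y
    by (auto simp: indicator_def intro!: power_mono)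
  have bound: "cmod (f y) \<le> card F" for y
    unfolding f_def by (rule order_trans[OF norm_sum]) (simp add: norm_mult)
  have "(card F / 2)\<^sup>2 * measure \<mu> (cball z r) = (LINT y|\<mu>. (card F / 2)\<^sup>2 * indicator (cball z r) y)"
    by simp
  also have "\<dots> \<le> (LINT y|\<mu>. (cmod (f y))\<^sup>2)"
  proof (rule integral_mono)
    show "integrable \<mu> (\<lambda>y. (card F / 2)\<^sup>2 * indicator (cball z r) y)"
      by (intro integrable_mult_right integrable_real_indicator) (auto simp: emeasure_eq_measure)
    show "integrable \<mu> (\<lambda>y. (cmod (f y))\<^sup>2)"
      by (rule integrable_bounded_nonneg[where C = "(card F)\<^sup>2"])
        (use meas bound in \<open>auto intro!: power_mono\<close>)
  qed (rule point)
  also have "\<dots> \<le> D * (\<Sum>l\<in>F. (cmod (exponential (- l) z))\<^sup>2)"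
    unfolding f_def
    by (rule conjunct2[OF riesz[unfolded riesz_bounds_def, rule_format]]) (use F in auto)
  finally have "card F * (card F * measure \<mu> (cball z r)) \<le> card F * (4 * D)"
    by (simp add: power2_eq_square field_simps)
  then show ?thesis using False F(1) by (simp add: card_gt_0_iff)
qed

text \<open>The level \<open>n\<close> is the first at which the radius
  \<open>r / \<rho> ^ n\<close> of a piece is at most \<open>1 / (6 * h)\<close>. Being the first
  costs no more than a factor \<open>\<rho>\<close>, so \<open>card B ^ n\<close>, the reciprocal of
  the mass of a piece, is of the order of \<open>h powr sim_dim\<close>.\<close>

lemma card_le_powr_sim_dim:
  assumes riesz: "riesz_bounds \<mu> \<Lambda> exponential C D" and "D \<ge> 0"
  obtains K where "K \<ge> 0"
    "\<And>F x h. finite F \<Longrightarrow> F \<subseteq> \<Lambda> \<inter> ball x h \<Longrightarrow> h \<ge> 1 \<Longrightarrow> card F \<le> K * h powr sim_dim"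
proof -
  obtain r where r: "r \<ge> 1" "measure \<mu> (cball 0 r) \<ge> 1/2" using exists_cball_half by blast
  define K where "K = 8 * D * (6 * \<rho> * r) powr sim_dim"
  have "card F \<le> K * h powr sim_dim" if F: "finite F" "F \<subseteq> \<Lambda> \<inter> ball x h" and h: "h \<ge> 1" for F x h
  proof -
    define t where "t = 6 * h * r"
    have "6 * (1 * 1) \<le> 6 * (h * r)" using h r by (intro mult_left_mono mult_mono) auto
    then have t: "t \<ge> 1" by (simp add: t_def)
    define n where "n = nat \<lceil>log \<rho> t\<rceil>"
    have "log \<rho> t \<ge> 0" using t rho by simp
    then have n: "log \<rho> t \<le> n" "real n \<le> 1 + log \<rho> t" unfolding n_def by linarith+
    have "\<rho> powr log \<rho> t \<le> \<rho> powr n" using n rho by (intro powr_mono) auto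
    then have lower: "t \<le> \<rho> ^ n" using t rho by (simp add: powr_realpow)
    have "\<rho> powr n \<le> \<rho> powr (1 + log \<rho> t)" using n rho by (intro powr_mono) auto
    then have upper: "\<rho> ^ n \<le> \<rho> * t" using t rho by (simp add: powr_realpow powr_add)
    obtain z where z: "z \<in> level_points n"
      using card_level_points[of n] card_B_pos by (metis card.empty ex_in_conv power_eq_0_iff less_irrefl)
    have "r / \<rho> ^ n \<le> r / t" using lower t r by (intro divide_left_mono) auto
    also have "r / t = 1 / (6 * h)" using r h by (simp add: t_def)
    finally have rad: "r / \<rho> ^ n \<le> 1 / (6 * h)" .
    have "card F * (1 / (2 * real (card B) ^ n)) \<le> card F * measure \<mu> (cball z (r / \<rho> ^ n))"
      by (intro mult_left_mono measure_small_cball r z) auto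
    also have "\<dots> \<le> 4 * D"
      using card_le_of_Bessel[OF riesz F _ rad \<open>D \<ge> 0\<close>] h by simp
    finally have "card F \<le> 8 * D * real (card B) ^ n"
      using card_B_pos by (simp add: field_simps)
    also have "real (card B) ^ n = (\<rho> ^ n) powr sim_dim"
      using rho_power_powr_sim_dim[of n 1] card_B_pos by simp
    also have "8 * D * (\<rho> ^ n) powr sim_dim \<le> 8 * D * (\<rho> * t) powr sim_dim"
      using \<open>D \<ge> 0\<close> upper rho sim_dim_nonneg by (intro mult_left_mono powr_mono2) auto
    also have "\<rho> * t = (6 * \<rho> * r) * h" by (simp add: t_def)
    also have "8 * D * ((6 * \<rho> * r) * h) powr sim_dim = K * h powr sim_dim"
      using h r rho by (simp add: K_def powr_mult)
    finally show ?thesis .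
  qed
  moreover have "K \<ge> 0" using \<open>D \<ge> 0\<close> by (simp add: K_def)
  ultimately show thesis using that by blast
qed

lemma upper_beurling_density_eq_0:
  assumes riesz: "riesz_bounds \<mu> \<Lambda> exponential C D" "D \<ge> 0" and \<alpha>: "\<alpha> > sim_dim"
  shows "upper_beurling_density \<alpha> \<Lambda> = 0"
proof -
  obtain K where K: "K \<ge> 0"
    "\<And>F x h. finite F \<Longrightarrow> F \<subseteq> \<Lambda> \<inter> ball x h \<Longrightarrow> h \<ge> 1 \<Longrightarrow> card F \<le> K * h powr sim_dim"
    using card_le_powr_sim_dim[OF riesz] by metis
  have count: "emeasure (count_space UNIV) (\<Lambda> \<inter> ball x h) \<le> ennreal (K * h powr sim_dim)" if "h \<ge> 1" for x h
  proof -
    have "finite (\<Lambda> \<inter> ball x h)"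
    proof (rule ccontr)
      \<comment> \<open>An infinite intersection would contain finite sets of every size, against
        the uniform bound; so the extended count is an ordinary cardinality.\<close>
      assume "infinite (\<Lambda> \<inter> ball x h)"
      then obtain F where "finite F" "card F = nat \<lceil>K * h powr sim_dim\<rceil> + 1" "F \<subseteq> \<Lambda> \<inter> ball x h"
        using infinite_arbitrarily_large by blast
      moreover from this have "card F \<le> K * h powr sim_dim" using K(2) \<open>h \<ge> 1\<close> by blast
      ultimately show False by linarith
    qed
    then show ?thesis
      using K(2)[OF _ order_refl \<open>h \<ge> 1\<close>] by (simp add: emeasure_count_space_finite ennreal_of_nat_eq_real_of_nat ennreal_leI)
  qed
  have "(SUP x. emeasure (count_space UNIV) (\<Lambda> \<inter> ball x h) / ennreal (h powr \<alpha>))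
      \<le> ennreal (K * h powr (sim_dim - \<alpha>))" if "h \<ge> 1" for h
  proof (rule SUP_least)
    fix x
    have "emeasure (count_space UNIV) (\<Lambda> \<inter> ball x h) / ennreal (h powr \<alpha>)
        \<le> ennreal (K * h powr sim_dim) / ennreal (h powr \<alpha>)"
      by (intro divide_right_mono_ennreal count that)
    also have "\<dots> = ennreal (K * h powr sim_dim / h powr \<alpha>)"
      using K that by (intro divide_ennreal) auto
    also have "K * h powr sim_dim / h powr \<alpha> = K * h powr (sim_dim - \<alpha>)"
      by (simp add: powr_diff)
    finally show "emeasure (count_space UNIV) (\<Lambda> \<inter> ball x h) / ennreal (h powr \<alpha>)
        \<le> ennreal (K * h powr (sim_dim - \<alpha>))" .
  qed
  then have "upper_beurling_density \<alpha> \<Lambda> \<le> Limsup at_top (\<lambda>h. ennreal (K * h powr (sim_dim - \<alpha>)))"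
    unfolding upper_beurling_density_def
    by (intro Limsup_mono eventually_at_top_linorderI[of 1]) auto
  also have "\<dots> = 0"
  proof (rule lim_imp_Limsup)
    have "((\<lambda>h. K * h powr (sim_dim - \<alpha>)) \<longlongrightarrow> K * 0) at_top"
      using \<alpha> by (intro tendsto_intros tendsto_neg_powr filterlim_ident) auto
    then show "((\<lambda>h. ennreal (K * h powr (sim_dim - \<alpha>))) \<longlongrightarrow> 0) at_top"
      using tendsto_ennrealI by fastforce
  qed simp
  finally show ?thesis by simp
qed

section \<open>The Beurling dimension\<close>

text \<open>An upper limit of a supremum over centres is bounded below by the balls around 0 along
  any unbounded set of radii. The finite set \<open>F\<close> keeps \<open>card\<close> meaningful,
  as it would be 0 for an infinite intersection.\<close>

lemma upper_beurling_density_pos: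
  assumes "\<And>m::nat. \<exists>F h. finite F \<and> F \<subseteq> \<Lambda> \<and> h \<ge> real m \<and> h powr \<alpha> \<le> card (F \<inter> ball 0 h)"
  shows "upper_beurling_density \<alpha> \<Lambda> > 0"
proof (rule ccontr)
  let ?q = "\<lambda>h. SUP x. emeasure (count_space UNIV) (\<Lambda> \<inter> ball x h) / ennreal (h powr \<alpha>)"
  assume "\<not> ?thesis"
  then have "Limsup at_top ?q < 1" by (simp add: upper_beurling_density_def)
  then have "eventually (\<lambda>h. ?q h < 1) at_top" by (rule Limsup_lessD)
  then obtain c where c: "\<And>h. h \<ge> c \<Longrightarrow> ?q h < 1" by (auto simp: eventually_at_top_linorder)
  obtain m :: nat where m: "max c 1 \<le> real m" using real_arch_simple by blast
  obtain F h where F: "finite F" "F \<subseteq> \<Lambda>" and h: "h \<ge> real m" "h powr \<alpha> \<le> card (F \<inter> ball 0 h)"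
    using assms by blast
  have h1: "h \<ge> c" "h > 0" using h m by auto
  have "ennreal (h powr \<alpha>) \<le> ennreal (card (F \<inter> ball 0 h))" using h by (intro ennreal_leI)
  also have "\<dots> = emeasure (count_space UNIV) (F \<inter> ball 0 h)"
    using F by (simp add: emeasure_count_space_finite ennreal_of_nat_eq_real_of_nat)
  also have "\<dots> \<le> emeasure (count_space UNIV) (\<Lambda> \<inter> ball 0 h)"
    using F by (intro emeasure_mono) auto
  finally have "ennreal (h powr \<alpha>) / ennreal (h powr \<alpha>)
      \<le> emeasure (count_space UNIV) (\<Lambda> \<inter> ball 0 h) / ennreal (h powr \<alpha>)"
    by (rule divide_right_mono_ennreal)
  also have "ennreal (h powr \<alpha>) / ennreal (h powr \<alpha>) = 1"
    using h1 by (intro ennreal_divide_self) auto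
  also have "emeasure (count_space UNIV) (\<Lambda> \<inter> ball 0 h) / ennreal (h powr \<alpha>) \<le> ?q h"
    by (rule SUP_upper) simp
  finally show False using c[OF h1(1)] by simp
qed

lemma beurling_dim_eq_sim_dim:
  assumes riesz: "riesz_bounds \<mu> \<Lambda> exponential C D" "D \<ge> 0"
    and dense: "\<And>J::nat. \<exists>F h. finite F \<and> F \<subseteq> \<Lambda> \<and> h \<ge> real J \<and>
      h powr ((1 - 1 / (real J + 2)) * sim_dim) \<le> card (F \<inter> ball 0 h)"
  shows "beurling_dim \<Lambda> = ereal sim_dim"
proof -
  define \<gamma> where "\<gamma> J = (1 - 1 / (real J + 2)) * sim_dim" for J
  let ?A = "{ereal \<alpha> | \<alpha>. 0 \<le> \<alpha> \<and> upper_beurling_density \<alpha> \<Lambda> > 0}"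
  have mem: "ereal (\<gamma> J) \<in> ?A" for J
  proof -
    have "\<exists>F h. finite F \<and> F \<subseteq> \<Lambda> \<and> h \<ge> real m \<and> h powr \<gamma> J \<le> card (F \<inter> ball 0 h)" for m
    proof -
      \<comment> \<open>\<open>dense\<close> gives one radius per index. A larger index supplies a
        radius beyond \<open>m\<close> with a larger exponent, and the 1 ensures
        \<open>h \<ge> 1\<close>, where \<open>powr\<close> increases with the exponent.\<close>
      define J' where "J' = max (max J m) 1"
      obtain F h where F: "finite F" "F \<subseteq> \<Lambda>" "h \<ge> real J'" "h powr \<gamma> J' \<le> card (F \<inter> ball 0 h)"
        using dense[of J'] unfolding \<gamma>_def by blast
      have J': "J \<le> J'" "m \<le> J'" "1 \<le> J'" by (auto simp: J'_def)
      then have h: "h \<ge> 1" "h \<ge> real m" using F(3) by linarith+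
      have "1 / (real J' + 2) \<le> 1 / (real J + 2)" using J' by (intro divide_left_mono) auto
      then have "\<gamma> J \<le> \<gamma> J'"
        unfolding \<gamma>_def using sim_dim_nonneg by (intro mult_right_mono) auto
      then have "h powr \<gamma> J \<le> h powr \<gamma> J'" using h by (intro powr_mono) auto
      then show ?thesis using F h by (intro exI[of _ F] exI[of _ h]) auto
    qed
    then have "upper_beurling_density (\<gamma> J) \<Lambda> > 0" by (rule upper_beurling_density_pos)
    moreover have "\<gamma> J \<ge> 0"
      unfolding \<gamma>_def using sim_dim_nonneg by (intro mult_nonneg_nonneg) (auto simp: field_simps)
    ultimately show ?thesis by blast
  qed
  have "(\<lambda>J. 1 / (real J + 2)) \<longlonglongrightarrow> 0"
    using LIMSEQ_ignore_initial_segment[OF lim_1_over_n[where 'a = real], of 2] by (simp add: add.commute)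
  then have "\<gamma> \<longlonglongrightarrow> (1 - 0) * sim_dim"
    unfolding \<gamma>_def by (intro tendsto_intros)
  then have lim: "(\<lambda>J. ereal (\<gamma> J)) \<longlonglongrightarrow> ereal sim_dim" by simp
  have "ereal sim_dim \<le> Sup ?A"
    using mem by (intro LIMSEQ_le_const2[OF lim]) (auto intro: Sup_upper)
  moreover have "Sup ?A \<le> ereal sim_dim"
  proof (rule Sup_least, clarify)
    fix \<alpha> assume "upper_beurling_density \<alpha> \<Lambda> > 0"
    then show "ereal \<alpha> \<le> ereal sim_dim"
      using upper_beurling_density_eq_0[OF riesz, of \<alpha>] by (cases "\<alpha> > sim_dim") auto
  qed
  ultimately show ?thesis unfolding beurling_dim_def by (intro antisym)
qed

end

theorem theorem5p8:
  fixes R Q :: "real ^ 'n ^ 'n" and \<rho> :: real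
    and B :: "(real ^ 'n) set" and \<mu> :: "(real ^ 'n) measure"
  assumes "\<rho> > 1" and "orthogonal_matrix Q" and "R = \<rho> *\<^sub>R Q" and "integer_matrix R"
    and "finite B" and "B \<noteq> {}" and "B \<subseteq> integer_lattice"
    and "inj_on (\<lambda>b. (+) b ` (*v) R ` integer_lattice) B"
    and "is_self_similar_measure R B \<mu>"
    and "no_overlap R B \<mu>"
  shows "\<exists>\<Lambda> :: (real ^ 'n) set. countable \<Lambda> \<and>
           beurling_dim \<Lambda> = ereal (log \<rho> (real (card B))) \<and>
           riesz_sequence_L2 \<mu> \<Lambda> exponential"
proof -
  interpret self_similar R Q \<rho> B \<mu>
    by unfold_locales (fact assms)+
  obtain \<Lambda> where \<Lambda>: "countable \<Lambda>" and riesz: "riesz_bounds \<mu> \<Lambda> exponential (1/2) 2"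
    and dense: "\<And>J::nat. \<exists>F h. finite F \<and> F \<subseteq> \<Lambda> \<and> h \<ge> real J \<and>
      h powr ((1 - 1 / (real J + 2)) * sim_dim) \<le> card (F \<inter> ball 0 h)"
    using exists_dense_riesz_frequencies by blast
  have "beurling_dim \<Lambda> = ereal (log \<rho> (real (card B)))"
    using beurling_dim_eq_sim_dim[OF riesz _ dense] by (simp add: sim_dim_def)
  moreover have "riesz_sequence_L2 \<mu> \<Lambda> exponential"
    by (rule riesz_sequence_exponential[OF riesz]) auto
  ultimately show ?thesis using \<Lambda> by blast
qed

end
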